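(* Let $k\ge 1$, let $\mathbf m=(m_1,\ldots,m_k)\in\mathbb{N}^k$ with $m_1\ge1$, let $\mathbf a=(a_1,\ldots,a_k)\in\mathbb{N}^k$, and let $\mathcal O\subseteq\{(r,s)\mid 1\le r<s\le k\}$. Put $$C(\mathbf m,\mathbf a,\mathcal O;k)=\sum_{i=1}^k\left[m_i(2^{k-i+1}-1)+a_i\right]+|\mathcal O|.$$ Then $$k\,\Delta(\mathbf m,\mathbf a,\mathcal O;k)\ \ge\ C(\mathbf m,\mathbf a,\mathcal O;k).$$
   Context: $\mathbb{N}$ includes $0$. A mass distribution (or mass) on $\mathbb{R}^d$ is a positive, finite Borel measure $\mu$ such that every hyperplane has $\mu$-measure zero. Given hyperplanes $H_1,\ldots,H_\ell$ in $\mathbb{R}^d$, $H_i=\{\mathbf u\mid \langle \mathbf u,\mathbf a_i\rangle=b_i\}$ with $(\mathbf a_i,b_i)\in S^{d-1}\times\mathbb{R}$, put $H_i^0=\{\mathbf u\mid \langle \mathbf u,\mathbf a_i\rangle\ge b_i\}$ and $H_i^1=\{\mathbf u\mid \langle \mathbf u,\mathbf a_i\rangle\le b_i\}$. The hyperplanes $H_1,\ldots,H_\ell$ equipartition $\mu$ if $\mu(H_1^{g_1}\cap\cdots\cap H_\ell^{g_\ell})=\frac{1}{2^\ell}\mu(\mathbb{R}^d)$ for all $(g_1,\ldots,g_\ell)\in\{0,1\}^\ell$. Two hyperplanes are orthogonal, $H_r\perp H_s$, if their normal vectors are orthogonal. $\Delta(\mathbf m,\mathbf a,\mathcal O;k)$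 denotes the minimum dimension $d$ (with $d\ge a_i$ for all $i$) such that, for any family of masses $\{\mu_{i,j}\}_{1\le i\le k,\,1\le j\le m_i}$ on $\mathbb{R}^d$ and any $k$ affine subspaces $A_1,\ldots,A_k$ of $\mathbb{R}^d$ with $\dim A_i=a_i-1$ (where $\dim A_i=-1$ means $A_i=\emptyset$), there exist $k$ hyperplanes $H_1,\ldots,H_k$ in $\mathbb{R}^d$ such that (i) $H_r\perp H_s$ for all $(r,s)\in\mathcal O$; (ii) $A_i\subseteq H_i$ for all $1\le i\le k$; and (iii) for each $1\le i\le k$, the hyperplanes $H_i,\ldots,H_k$ equipartition each of $\mu_{i,1},\ldots,\mu_{i,m_i}$. *)

theory Defs
  imports "HOL-Analysis.Analysis" "HOL-Library.Function_Algebras"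
begin

text \<open>
  The minimum defining \<open>\<Delta>\<close> ranges over the dimension \<open>d\<close>, so \<open>d\<close> has to be a term.  We use the
  library's \<open>Euclidean_space d\<close>, whose points are the functions \<open>nat \<Rightarrow> real\<close> that vanish at all
  indices \<open>i \<ge> d\<close>.  The pointwise real vector space structure below makes \<open>affine\<close>,
  \<open>affine hull\<close> and \<open>affine_dependent\<close> available on this type.
\<close>

instantiation "fun" :: (type, real_vector) real_vector
begin

definition scaleR_fun :: "real \<Rightarrow> ('a \<Rightarrow> 'b) \<Rightarrow> 'a \<Rightarrow> 'b"
  where "scaleR_fun c f = (\<lambda>x. c *\<^sub>R f x)"

instance
  by standard (simp_all add: scaleR_fun_def fun_eq_iff scaleR_add_right scaleR_add_left)

end

abbreviation Rd :: "nat \<Rightarrow> (nat \<Rightarrow> real) set"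
  where "Rd d \<equiv> topspace (Euclidean_space d)"

definition ip :: "nat \<Rightarrow> (nat \<Rightarrow> real) \<Rightarrow> (nat \<Rightarrow> real) \<Rightarrow> real"
  where "ip d u v = (\<Sum>i<d. u i * v i)"

text \<open>The unit sphere of \<open>Rd d\<close>, of dimension \<open>d - 1\<close>; it is empty for \<open>d = 0\<close>.\<close>

definition unit_sphere :: "nat \<Rightarrow> (nat \<Rightarrow> real) set"
  where "unit_sphere d = {v \<in> Rd d. ip d v v = 1}"

text \<open>
  A hyperplane is given by a pair \<open>(v, b)\<close> with \<open>v \<in> unit_sphere d\<close>; the pair \<open>(-v, -b)\<close> gives the
  same hyperplane with its two half-spaces exchanged.
\<close>

definition hyperplane :: "nat \<Rightarrow> (nat \<Rightarrow> real) \<Rightarrow> real \<Rightarrow> (nat \<Rightarrow> real) set"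
  where "hyperplane d v b = {u \<in> Rd d. ip d u v = b}"

definition halfspace :: "nat \<Rightarrow> (nat \<Rightarrow> real) \<Rightarrow> real \<Rightarrow> nat \<Rightarrow> (nat \<Rightarrow> real) set"
  where "halfspace d v b g =
    (if g = 0 then {u \<in> Rd d. ip d u v \<ge> b} else {u \<in> Rd d. ip d u v \<le> b})"

definition mass :: "nat \<Rightarrow> (nat \<Rightarrow> real) measure \<Rightarrow> bool"
  where "mass d \<mu> \<longleftrightarrow>
    sets \<mu> = sets (restrict_space borel (Rd d)) \<and>
    0 < emeasure \<mu> (Rd d) \<and> emeasure \<mu> (Rd d) < \<infinity> \<and>
    (\<forall>v\<in>unit_sphere d. \<forall>b. emeasure \<mu> (hyperplane d v b) = 0)"

text \<open>The hyperplanes given by \<open>(v j, b j)\<close> for \<open>j \<in> J\<close> equipartition \<open>\<mu>\<close>.\<close>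

definition equipartition ::
    "nat \<Rightarrow> nat set \<Rightarrow> (nat \<Rightarrow> nat \<Rightarrow> real) \<Rightarrow> (nat \<Rightarrow> real) \<Rightarrow> (nat \<Rightarrow> real) measure \<Rightarrow> bool"
  where "equipartition d J v b \<mu> \<longleftrightarrow>
    (\<forall>g \<in> J \<rightarrow> {0, 1::nat}.
      measure \<mu> (\<Inter>j\<in>J. halfspace d (v j) (b j) (g j)) = measure \<mu> (Rd d) / 2 ^ card J)"

text \<open>
  Affine subspaces of \<open>Rd d\<close> of dimension \<open>n - 1\<close>, where \<open>n = 0\<close> gives the empty set.  The library's
  \<open>aff_dim\<close> needs a \<open>euclidean_space\<close> type, so we state its defining property: the subspace is the
  affine hull of \<open>n\<close> affinely independent points.
\<close>

definition affine_subspace :: "nat \<Rightarrow> nat \<Rightarrow> (nat \<Rightarrow> real) set \<Rightarrow> bool"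
  where "affine_subspace d n A \<longleftrightarrow>
    (\<exists>B. finite B \<and> card B = n \<and> B \<subseteq> Rd d \<and> \<not> affine_dependent B \<and> A = affine hull B)"

text \<open>
  Indices run through \<open>1, \<dots>, k\<close>; the values of \<open>m\<close> and \<open>a\<close> elsewhere play no role.
\<close>

definition admissible ::
    "(nat \<Rightarrow> nat) \<Rightarrow> (nat \<Rightarrow> nat) \<Rightarrow> (nat \<times> nat) set \<Rightarrow> nat \<Rightarrow> nat \<Rightarrow> bool"
  where "admissible m a \<O> k d \<longleftrightarrow>
    (\<forall>i\<in>{1..k}. a i \<le> d) \<and>
    (\<forall>\<mu> A.
      (\<forall>i\<in>{1..k}. \<forall>j\<in>{1..m i}. mass d (\<mu> i j)) \<longrightarrow>
      (\<forall>i\<in>{1..k}. affine_subspace d (a i) (A i)) \<longrightarrow>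
      (\<exists>v b.
        (\<forall>i\<in>{1..k}. v i \<in> unit_sphere d) \<and>
        (\<forall>(r, s)\<in>\<O>. ip d (v r) (v s) = 0) \<and>
        (\<forall>i\<in>{1..k}. A i \<subseteq> hyperplane d (v i) (b i)) \<and>
        (\<forall>i\<in>{1..k}. \<forall>j\<in>{1..m i}. equipartition d {i..k} v b (\<mu> i j))))"

text \<open>
  The minimum is taken in \<open>enat\<close>: it is attained whenever an admissible dimension exists, and is
  \<open>\<infinity>\<close> otherwise.
\<close>

definition Delta :: "(nat \<Rightarrow> nat) \<Rightarrow> (nat \<Rightarrow> nat) \<Rightarrow> (nat \<times> nat) set \<Rightarrow> nat \<Rightarrow> enat"
  where "Delta m a \<O> k = (INF d \<in> {d. admissible m a \<O> k d}. enat d)"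

definition C_bound :: "(nat \<Rightarrow> nat) \<Rightarrow> (nat \<Rightarrow> nat) \<Rightarrow> (nat \<times> nat) set \<Rightarrow> nat \<Rightarrow> nat"
  where "C_bound m a \<O> k = (\<Sum>i=1..k. m i * (2 ^ (k - i + 1) - 1) + a i) + card \<O>"

end

theory Submission
  imports Defs "HOL-Computational_Algebra.Polynomial"
begin

text \<open>
  Why the inequality holds.  Let \<open>d\<close> be admissible.  Feed the defining property of \<open>d\<close> with masses that
  sit close to finitely many points in general position: \<open>\<mu> i j\<close> is spread evenly over small arcs
  around \<open>2 ^ (k - i + 1) - 1\<close> points, and \<open>A i\<close> is the affine hull of \<open>a i\<close> points.  An orthant of the
  hyperplanes with indices \<open>i, \<dots>, k\<close> receives the fraction \<open>1 / 2 ^ (k - i + 1)\<close> of \<open>\<mu> i j\<close>, which is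
  less than the share of a single arc, so no arc fits into an orthant and each arc is reached by some
  hyperplane.  Shrinking the arcs and passing to a limit of the hyperplanes, every one of the points
  lies exactly on a hyperplane (\<open>equipartition_hyperplane_near_point\<close>).  The limit exists because the
  normal vectors are unit vectors and because \<open>\<mu> 1 1\<close>, which is equipartitioned by all hyperplanes,
  keeps them at bounded distance from the origin (\<open>equipartition_offset_bounded\<close>).
  Each \<open>A i\<close> contributes \<open>a i\<close> further points on the \<open>i\<close>-th hyperplane.

  It remains to compare \<open>C - card \<O>\<close> incidences and \<open>card \<O>\<close> orthogonality relations with the \<open>k * d\<close>
  degrees of freedom of \<open>k\<close> hyperplanes.  The count is made rigorous by transcendence degree.  Let all
  coordinates of the \<open>N\<close> points be algebraically independent.  If \<open>k\<close> hyperplanes have their parameters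
  in a field generated by \<open>p\<close> reals, then a point on one of them is determined over that field by
  \<open>d - 1\<close> of its coordinates, so \<open>N * d \<le> p + N * (d - 1)\<close>, that is, \<open>N \<le> p\<close>
  (\<open>card_incidences_le\<close>).  What is needed is \<open>p \<le> k * d - card \<O>\<close>.

  The latter is a statement on the \<open>k\<close> normal vectors, chosen one after the other: a new vector lies in
  the orthogonal complement of earlier ones, and a linearly independent set of earlier constraints
  takes away one parameter per constraint.  Constraints can fail to be independent only if some earlier
  vector depended linearly on its predecessors.  Such a vector lies in a small subspace, and for
  \<open>k \<le> d\<close> the parameters saved there outweigh all later losses
  (\<open>orthogonal_family_parameters\<close>).  Finally \<open>k \<le> d\<close> is automatic: ignoring orthogonality, the count
  gives \<open>2 ^ k - 1 \<le> k * d\<close> from the mass \<open>\<mu> 1 1\<close> alone, and \<open>k * (k - 1) < 2 ^ k - 1\<close>.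
\<close>

section \<open>Fields generated by sets of reals\<close>

inductive_set field_gen :: "real set \<Rightarrow> real set" for X where
  gen: "x \<in> X \<Longrightarrow> x \<in> field_gen X"
| one: "1 \<in> field_gen X"
| diff: "x \<in> field_gen X \<Longrightarrow> y \<in> field_gen X \<Longrightarrow> x - y \<in> field_gen X"
| mult: "x \<in> field_gen X \<Longrightarrow> y \<in> field_gen X \<Longrightarrow> x * y \<in> field_gen X"
| inverse: "x \<in> field_gen X \<Longrightarrow> inverse x \<in> field_gen X"

lemma field_gen_zero: "0 \<in> field_gen X"
  using field_gen.diff[OF field_gen.one field_gen.one] by simp

lemma field_gen_uminus: "x \<in> field_gen X \<Longrightarrow> - x \<in> field_gen X"
  using field_gen.diff[OF field_gen_zero, of x] by simp

lemma field_gen_add: "x \<in> field_gen X \<Longrightarrow> y \<in> field_gen X \<Longrightarrow> x + y \<in> field_gen X"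
  using field_gen.diff[OF _ field_gen_uminus, of x X y] by simp

lemma field_gen_divide: "x \<in> field_gen X \<Longrightarrow> y \<in> field_gen X \<Longrightarrow> x / y \<in> field_gen X"
  by (simp add: divide_inverse field_gen.mult field_gen.inverse)

lemma field_gen_sum: "(\<And>i. i \<in> A \<Longrightarrow> f i \<in> field_gen X) \<Longrightarrow> (\<Sum>i\<in>A. f i) \<in> field_gen X"
  by (induction A rule: infinite_finite_induct) (auto intro: field_gen_zero field_gen_add)

lemma field_gen_power: "x \<in> field_gen X \<Longrightarrow> x ^ n \<in> field_gen X"
  by (induction n) (auto intro: field_gen.one field_gen.mult)

lemma field_gen_prod: "(\<And>i. i \<in> A \<Longrightarrow> f i \<in> field_gen X) \<Longrightarrow> (\<Prod>i\<in>A. f i) \<in> field_gen X"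
  by (induction A rule: infinite_finite_induct) (auto intro: field_gen.one field_gen.mult)

lemma field_gen_of_nat: "of_nat n \<in> field_gen X"
  by (induction n) (auto intro: field_gen.one field_gen_zero field_gen_add)

lemma field_gen_of_int: "of_int n \<in> field_gen X"
  by (cases n rule: int_cases2) (auto intro: field_gen_of_nat field_gen_uminus)

lemma field_gen_of_rat: "of_rat q \<in> field_gen X"
  by (cases q) (auto simp: of_rat_rat intro: field_gen_of_int field_gen_divide)

lemma field_gen_mono: "X \<subseteq> Y \<Longrightarrow> field_gen X \<subseteq> field_gen Y"
proof
  fix x assume "X \<subseteq> Y" "x \<in> field_gen X"
  from this(2,1) show "x \<in> field_gen Y"
    by induction (auto intro: field_gen.intros)
qed

text \<open>
  The field is exhausted by countably many rounds of applying the field operations, each of which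
  keeps the set countable.
\<close>

lemma countable_field_gen:
  assumes "countable X"
  shows "countable (field_gen X)"
proof -
  define F :: "real set \<Rightarrow> real set" where
    "F C = C \<union> (\<lambda>(x, y). x - y) ` (C \<times> C) \<union> (\<lambda>(x, y). x * y) ` (C \<times> C) \<union> inverse ` C" for C
  define C where "C n = (F ^^ n) (insert 1 X)" for n
  have C_Suc: "C (Suc n) = F (C n)" for n by (simp add: C_def)
  have "countable (C n)" for n
    by (induction n) (auto simp: C_Suc F_def C_def[of 0] assms)
  then have "countable (\<Union>n. C n)" by auto
  moreover have mono: "C m \<subseteq> C n" if "m \<le> n" for m n
    using that by (induction rule: dec_induct) (auto simp: C_Suc F_def)
  have "x \<in> (\<Union>n. C n)" if "x \<in> field_gen X" for x
    using that
  proof induction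
    case (gen x) then show ?case by (auto simp: C_def intro: exI[of _ 0])
  next
    case one show ?case by (auto simp: C_def intro: exI[of _ 0])
  next
    case (diff x y)
    then obtain m n where "x \<in> C m" "y \<in> C n" by auto
    then have "x \<in> C (max m n)" "y \<in> C (max m n)" using mono[of m "max m n"] mono[of n "max m n"] by auto
    then have "x - y \<in> C (Suc (max m n))" by (force simp: C_Suc F_def)
    then show ?case by blast
  next
    case (mult x y)
    then obtain m n where "x \<in> C m" "y \<in> C n" by auto
    then have "x \<in> C (max m n)" "y \<in> C (max m n)" using mono[of m "max m n"] mono[of n "max m n"] by auto
    then have "x * y \<in> C (Suc (max m n))" by (force simp: C_Suc F_def)
    then show ?case by blast
  next
    case (inverse x)
    then obtain m where "x \<in> C m" by auto
    then have "inverse x \<in> C (Suc m)" by (force simp: C_Suc F_def)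
    then show ?case by blast
  qed
  ultimately show ?thesis using countable_subset[of "field_gen X" "\<Union>n. C n"] by blast
qed

section \<open>Generic sequences of reals\<close>

text \<open>
  Each term is transcendental over the field generated by its predecessors.  Stating algebraic
  independence through univariate polynomials allows a term by term construction.
\<close>

definition generic :: "(nat \<Rightarrow> real) \<Rightarrow> bool" where
  "generic y \<longleftrightarrow> (\<forall>n p. range (coeff p) \<subseteq> field_gen (y ` {..<n}) \<longrightarrow> p \<noteq> 0 \<longrightarrow> poly p (y n) \<noteq> 0)"

text \<open>
  There are countably many polynomials over a countable field, with finitely many roots each.
\<close>

lemma exists_transcendental:
  assumes "countable K"
  shows "\<exists>z::real. \<forall>p. range (coeff p) \<subseteq> K \<longrightarrow> p \<noteq> 0 \<longrightarrow> poly p z \<noteq> 0"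
proof -
  define PP where "PP = {p::real poly. range (coeff p) \<subseteq> K \<and> p \<noteq> 0}"
  have "PP \<subseteq> Poly ` lists K"
  proof
    fix p assume "p \<in> PP"
    then have "coeff p i \<in> K" for i by (auto simp: PP_def)
    then have "coeffs p \<in> lists K" by (auto simp: coeffs_def)
    then show "p \<in> Poly ` lists K" by (metis Poly_coeffs imageI)
  qed
  then have "countable PP"
    by (rule countable_subset) (simp add: assms)
  then have "countable (\<Union>p\<in>PP. {z. poly p z = 0})"
    by (rule countable_UN) (auto simp: PP_def intro: countable_finite poly_roots_finite)
  then have "(\<Union>p\<in>PP. {z. poly p z = 0}) \<noteq> UNIV"
    using uncountable_UNIV_real by metis
  then show ?thesis by (auto simp: PP_def)
qed

lemma exists_generic: "\<exists>y. generic y"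
proof -
  define Q :: "(nat \<Rightarrow> real) \<Rightarrow> nat \<Rightarrow> real \<Rightarrow> bool" where
    "Q y n z \<longleftrightarrow> (\<forall>p. range (coeff p) \<subseteq> field_gen (y ` {..<n}) \<longrightarrow> p \<noteq> 0 \<longrightarrow> poly p z \<noteq> 0)" for y n z
  have "\<exists>y. \<forall>n. Q y n (y n)"
  proof (rule dependent_wf_choice[OF wf_less])
    fix f g :: "nat \<Rightarrow> real" and n :: nat and z assume "\<And>m. (m, n) \<in> {(x, y). x < y} \<Longrightarrow> f m = g m"
    then have "f ` {..<n} = g ` {..<n}" by (intro image_cong) auto
    then show "Q f n z = Q g n z" by (simp add: Q_def)
  next
    fix n y show "\<exists>z. Q y n z" unfolding Q_def
      by (rule exists_transcendental) (auto intro: countable_field_gen)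
  qed
  then show ?thesis by (auto simp: Q_def generic_def)
qed

text \<open>
  Algebraic independence in its multivariate form: a vanishing rational combination of distinct
  monomials in the first \<open>n\<close> terms is trivial.  Read as a polynomial in the last variable, such a
  combination has coefficients generated by the earlier terms, so all these coefficients vanish.
\<close>

lemma generic_monomials_independent:
  assumes y: "generic y" and "finite A" and "\<forall>\<alpha>\<in>A. \<forall>\<beta>\<in>A. \<alpha> \<noteq> \<beta> \<longrightarrow> (\<exists>i<n. \<alpha> i \<noteq> \<beta> i)"
    and "(\<Sum>\<alpha>\<in>A. of_rat (q \<alpha>) * (\<Prod>i<n. y i ^ \<alpha> i)) = 0" and "\<alpha> \<in> A"
  shows "q \<alpha> = 0"
  using assms(2-)
proof (induction n arbitrary: A \<alpha>)
  case 0
  then have "A = {\<alpha>}" by auto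
  with 0 show ?case by simp
next
  case (Suc n)
  define c where "c \<alpha> = of_rat (q \<alpha>) * (\<Prod>i<n. y i ^ \<alpha> i)" for \<alpha>
  define p where "p = (\<Sum>\<alpha>\<in>A. monom (c \<alpha>) (\<alpha> n))"
  have cf: "coeff p j = (\<Sum>\<alpha>\<in>{\<alpha>\<in>A. \<alpha> n = j}. c \<alpha>)" for j
    unfolding p_def coeff_sum using Suc.prems(1)
    by (simp add: sum.inter_filter)
  have "range (coeff p) \<subseteq> field_gen (y ` {..<n})"
    by (auto simp: cf c_def intro!: field_gen_sum field_gen.mult field_gen_of_rat field_gen_prod field_gen_power intro: field_gen.gen)
  moreover have "poly p (y n) = 0"
    using Suc.prems(3) by (simp add: p_def poly_sum poly_monom c_def mult_ac)
  ultimately have "p = 0" using y by (auto simp: generic_def)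
  then have 0: "(\<Sum>\<alpha>\<in>{\<beta>\<in>A. \<beta> n = \<alpha> n}. of_rat (q \<alpha>) * (\<Prod>i<n. y i ^ \<alpha> i)) = 0"
    using cf[of "\<alpha> n"] by (simp add: c_def)
  show ?case
  proof (rule Suc.IH[OF _ _ 0])
    show "\<forall>\<alpha>'\<in>{\<beta>\<in>A. \<beta> n = \<alpha> n}. \<forall>\<beta>\<in>{\<beta>\<in>A. \<beta> n = \<alpha> n}. \<alpha>' \<noteq> \<beta> \<longrightarrow> (\<exists>i<n. \<alpha>' i \<noteq> \<beta> i)"
    proof (intro ballI impI)
      fix \<alpha>' \<beta> assume *: "\<alpha>' \<in> {\<beta>\<in>A. \<beta> n = \<alpha> n}" "\<beta> \<in> {\<beta>\<in>A. \<beta> n = \<alpha> n}" "\<alpha>' \<noteq> \<beta>"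
      then obtain i where "i < Suc n" "\<alpha>' i \<noteq> \<beta> i" using Suc.prems(2) by auto
      with * show "\<exists>i<n. \<alpha>' i \<noteq> \<beta> i" by (auto simp: less_Suc_eq)
    qed
  qed (use Suc.prems in auto)
qed

section \<open>Generic terms in a finitely generated field\<close>

interpretation Q: vector_space "\<lambda>(q::rat) (r::real). of_rat q * r"
  by unfold_locales (auto simp: algebra_simps of_rat_add of_rat_mult)

text \<open>
  The degree \<open>e\<close> bounds the exponent of each single variable, so that products and the number of
  monomials are easy to control.
\<close>

definition monomials :: "real set \<Rightarrow> nat \<Rightarrow> real set" where
  "monomials X e = (\<lambda>\<alpha>. \<Prod>x\<in>X. x ^ \<alpha> x) ` (X \<rightarrow> {..e})"

text \<open>
  The values at \<open>X\<close> of rational polynomials of degree at most \<open>e\<close> in each variable.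
\<close>

definition poly_values :: "real set \<Rightarrow> nat \<Rightarrow> real set" where
  "poly_values X e = Q.span (monomials X e)"

lemma monomials_eq: "monomials X e = (\<lambda>\<alpha>. \<Prod>x\<in>X. x ^ \<alpha> x) ` (X \<rightarrow>\<^sub>E {..e})"
proof -
  have "(\<Prod>x\<in>X. x ^ \<alpha> x) = (\<Prod>x\<in>X. x ^ (restrict \<alpha> X) x)" for \<alpha> :: "real \<Rightarrow> nat"
    by (rule prod.cong) auto
  moreover have "restrict \<alpha> X \<in> X \<rightarrow>\<^sub>E {..e}" if "\<alpha> \<in> X \<rightarrow> {..e}" for \<alpha>
    using that by (simp add: restrict_PiE_iff Pi_iff)
  ultimately show ?thesis unfolding monomials_def
    unfolding image_def PiE_def by blast
qed

lemma monomials_mult: "x \<in> monomials X e \<Longrightarrow> y \<in> monomials X e' \<Longrightarrow> x * y \<in> monomials X (e + e')"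
proof -
  assume "x \<in> monomials X e" "y \<in> monomials X e'"
  then obtain \<alpha> \<beta> where *: "\<alpha> \<in> X \<rightarrow> {..e}" "\<beta> \<in> X \<rightarrow> {..e'}" "x = (\<Prod>x\<in>X. x ^ \<alpha> x)" "y = (\<Prod>x\<in>X. x ^ \<beta> x)"
    by (auto simp: monomials_def)
  then have "x * y = (\<Prod>x\<in>X. x ^ (\<alpha> x + \<beta> x))" by (simp add: prod.distrib power_add)
  moreover have "(\<lambda>x. \<alpha> x + \<beta> x) \<in> X \<rightarrow> {..e + e'}" using *(1,2) by (simp add: Pi_iff add_mono)
  ultimately show ?thesis unfolding monomials_def by (rule image_eqI)
qed

lemma card_monomials: "finite X \<Longrightarrow> finite (monomials X e) \<and> card (monomials X e) \<le> (e + 1) ^ card X"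
  unfolding monomials_eq
  using card_image_le[of "X \<rightarrow>\<^sub>E {..e}" "\<lambda>\<alpha>. \<Prod>x\<in>X. x ^ \<alpha> x"]
  by (simp add: finite_PiE card_PiE)

lemma poly_values_one: "1 \<in> poly_values X e"
  unfolding poly_values_def by (rule Q.span_base) (auto simp: monomials_def intro!: image_eqI[of _ _ "\<lambda>_. 0"])

lemma poly_values_gen: "finite X \<Longrightarrow> x \<in> X \<Longrightarrow> x \<in> poly_values X 1"
  unfolding poly_values_def monomials_def
proof (rule Q.span_base, rule image_eqI[of _ _ "\<lambda>y. if y = x then 1 else 0"])
  assume "finite X" "x \<in> X"
  have "(\<Prod>z\<in>X. z ^ (if z = x then 1 else 0)) = (\<Prod>z\<in>X. if z = x then x else 1)"
    by (rule prod.cong) auto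
  with \<open>finite X\<close> \<open>x \<in> X\<close> show "x = (\<Prod>z\<in>X. z ^ (if z = x then 1 else 0))" by simp
qed auto

lemma poly_values_mult:
  assumes "x \<in> poly_values X e" "y \<in> poly_values X e'"
  shows "x * y \<in> poly_values X (e + e')"
  using assms(1) unfolding poly_values_def
proof (induction rule: Q.span_induct_alt)
  case base show ?case by (simp add: Q.span_zero)
next
  case (step c x x')
  have "x * y \<in> Q.span (monomials X (e + e'))"
    using assms(2) unfolding poly_values_def
  proof (induction rule: Q.span_induct_alt)
    case base show ?case by (simp add: Q.span_zero)
  next
    case (step c' z z')
    have "x * z \<in> Q.span (monomials X (e + e'))"
      using monomials_mult \<open>x \<in> monomials X e\<close> step.hyps by (intro Q.span_base)
    from Q.span_add[OF Q.span_scale[OF this, of c'] step.IH] show ?case by (simp add: algebra_simps)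
  qed
  from Q.span_add[OF Q.span_scale[OF this, of c] step.IH] show ?case by (simp add: algebra_simps)
qed

lemma poly_values_power: "x \<in> poly_values X e \<Longrightarrow> x ^ n \<in> poly_values X (n * e)"
  by (induction n) (auto intro: poly_values_one poly_values_mult)

lemma poly_values_prod: "(\<And>i. i < n \<Longrightarrow> f i \<in> poly_values X e) \<Longrightarrow> (\<Prod>i<n. f i) \<in> poly_values X (n * e)"
  for n :: nat
  by (induction n) (auto intro: poly_values_one simp: mult.commute[of _ "f _"] intro!: poly_values_mult)

text \<open>
  Every element of the generated field is a quotient of two polynomials.  Allowing the same degree
  bound for both avoids a separate bookkeeping of numerators and denominators.
\<close>

lemma field_gen_denominator:
  assumes "finite X" "z \<in> field_gen X"
  shows "\<exists>e g. g \<noteq> 0 \<and> g \<in> poly_values X e \<and> g * z \<in> poly_values X e"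
  using assms(2)
proof induction
  case (gen x)
  then show ?case using poly_values_gen[OF assms(1), of x] poly_values_one[of X 1] by (intro exI[of _ 1] exI[of _ 1]) auto
next
  case one
  then show ?case using poly_values_one[of X 1] by (intro exI[of _ 1] exI[of _ 1]) auto
next
  case (diff x y)
  then obtain e g e' g' where g: "g \<noteq> 0" "g \<in> poly_values X e" "g * x \<in> poly_values X e"
      "g' \<noteq> 0" "g' \<in> poly_values X e'" "g' * y \<in> poly_values X e'" by blast
  then have "(g * x) * g' - g * (g' * y) \<in> poly_values X (e + e')"
    using poly_values_mult unfolding poly_values_def by (blast intro: Q.span_diff)
  then have "g * g' * (x - y) \<in> poly_values X (e + e')" by (simp add: algebra_simps)
  with g show ?case by (intro exI[of _ "e + e'"] exI[of _ "g * g'"]) (auto intro: poly_values_mult)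
next
  case (mult x y)
  then obtain e g e' g' where g: "g \<noteq> 0" "g \<in> poly_values X e" "g * x \<in> poly_values X e"
      "g' \<noteq> 0" "g' \<in> poly_values X e'" "g' * y \<in> poly_values X e'" by blast
  then have "(g * x) * (g' * y) \<in> poly_values X (e + e')" using poly_values_mult by blast
  then have "g * g' * (x * y) \<in> poly_values X (e + e')" by (simp add: mult_ac)
  with g show ?case by (intro exI[of _ "e + e'"] exI[of _ "g * g'"]) (auto intro: poly_values_mult)
next
  case (inverse x)
  show ?case
  proof (cases "x = 0")
    case True
    then show ?thesis using inverse.IH by simp
  next
    case False
    from inverse.IH obtain e g where "g \<noteq> 0" "g \<in> poly_values X e" "g * x \<in> poly_values X e" by blast
    moreover have "g * x * inverse x = g" using False by simp
    ultimately show ?thesis using False by (metis mult_eq_0_iff)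
  qed
qed

lemma field_gen_common_denominator:
  assumes "finite X" "finite I" "\<And>i. i \<in> I \<Longrightarrow> z i \<in> field_gen X"
  shows "\<exists>e g. g \<noteq> 0 \<and> g \<in> poly_values X e \<and> (\<forall>i\<in>I. g * z i \<in> poly_values X e)"
  using assms(2,3)
proof (induction I rule: finite_induct)
  case empty
  then show ?case using poly_values_one[of X 1] by (intro exI[of _ 1] exI[of _ 1]) auto
next
  case (insert i I)
  then obtain e g where g: "g \<noteq> 0" "g \<in> poly_values X e" "\<forall>i\<in>I. g * z i \<in> poly_values X e" by auto
  obtain e' g' where g': "g' \<noteq> 0" "g' \<in> poly_values X e'" "g' * z i \<in> poly_values X e'"
    using field_gen_denominator[OF assms(1)] insert.prems by blast
  have "g * g' * z j \<in> poly_values X (e + e')" if "j \<in> insert i I" for j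
  proof (cases "j = i")
    case True
    then show ?thesis using poly_values_mult[OF g(2) g'(3)] by (simp add: mult_ac)
  next
    case False
    then show ?thesis using poly_values_mult[of "g * z j" X e g' e'] g g' that by (simp add: mult_ac)
  qed
  with g g' show ?case by (intro exI[of _ "e + e'"] exI[of _ "g * g'"]) (auto intro: poly_values_mult)
qed

text \<open>
  The transcendence degree of a field generated by \<open>card Z\<close> reals is at most \<open>card Z\<close>.  With a common
  denominator \<open>g\<close>, the \<open>M ^ n\<close> monomials in the \<open>y i\<close> with exponents below \<open>M\<close> become polynomials in \<open>Z\<close>
  of degree at most \<open>n * M * e\<close> after multiplication with \<open>g ^ (n * M)\<close>.  These form a space of dimension
  \<open>O(M ^ card Z)\<close> over the rationals, while the monomials in the \<open>y i\<close> are linearly independent; for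
  large \<open>M\<close> this forces \<open>n \<le> card Z\<close>.
\<close>

lemma generic_initial_le_card:
  assumes y: "generic y" and Z: "finite Z" and sub: "y ` {..<n} \<subseteq> field_gen Z"
  shows "n \<le> card Z"
proof (rule ccontr)
  assume "\<not> n \<le> card Z"
  obtain e g where g: "g \<noteq> 0" "g \<in> poly_values Z e" "\<And>i. i < n \<Longrightarrow> g * y i \<in> poly_values Z e"
    using field_gen_common_denominator[OF Z, of "{..<n}" y] sub by (auto simp: image_subset_iff)
  \<comment> \<open>large enough for the final comparison of \<open>M ^ n\<close> with \<open>((n * e + 1) * M) ^ card Z\<close>\<close>
  define M where "M = (n * e + 1) ^ card Z + 1"
  define E where "E = ({..<n} \<rightarrow>\<^sub>E {..<M})"
  define mon where "mon \<alpha> = (\<Prod>i<n. y i ^ \<alpha> i)" for \<alpha>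
  define G where "G = g ^ (n * M)"
  have "finite E" by (simp add: E_def finite_PiE)
  have sep: "\<exists>i<n. \<alpha> i \<noteq> \<beta> i" if "\<alpha> \<in> E" "\<beta> \<in> E" "\<alpha> \<noteq> \<beta>" for \<alpha> \<beta>
    using that unfolding E_def by (metis PiE_ext lessThan_iff)
  have inj: "inj_on mon E"
  proof
    fix \<alpha> \<beta> assume *: "\<alpha> \<in> E" "\<beta> \<in> E" "mon \<alpha> = mon \<beta>"
    show "\<alpha> = \<beta>"
    proof (rule ccontr)
      assume "\<alpha> \<noteq> \<beta>"
      have "(if \<alpha> = \<alpha> then 1 else - 1 :: rat) = 0"
        by (rule generic_monomials_independent[OF y, of "{\<alpha>, \<beta>}" n "\<lambda>\<gamma>. if \<gamma> = \<alpha> then 1 else - 1"])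
          (use * sep[of \<alpha> \<beta>] sep[of \<beta> \<alpha>] \<open>\<alpha> \<noteq> \<beta>\<close> in \<open>auto simp: mon_def\<close>)
      then show False by simp
    qed
  qed
  have indep: "Q.independent (mon ` E)"
    unfolding Q.dependent_explicit
  proof clarify
    fix t u v assume t: "finite t" "t \<subseteq> mon ` E" "(\<Sum>v\<in>t. of_rat (u v) * v) = 0" "v \<in> t" "u v \<noteq> 0"
    define A where "A = {\<alpha>\<in>E. mon \<alpha> \<in> t}"
    have "t = mon ` A" using t(2) by (auto simp: A_def)
    moreover have "inj_on mon A" using inj by (auto simp: A_def inj_on_def)
    ultimately have "(\<Sum>\<alpha>\<in>A. of_rat (u (mon \<alpha>)) * mon \<alpha>) = 0"
      using t(3) by (simp add: sum.reindex)
    moreover obtain \<alpha> where "\<alpha> \<in> A" "v = mon \<alpha>" using \<open>t = mon ` A\<close> t(4) by auto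
    ultimately have "u (mon \<alpha>) = 0"
      using generic_monomials_independent[OF y, of A n "u \<circ> mon" \<alpha>] sep \<open>finite E\<close>
      by (auto simp: A_def mon_def o_def)
    with t \<open>v = mon \<alpha>\<close> show False by simp
  qed
  have "mon \<alpha> \<in> Q.span ((\<lambda>t. t / G) ` monomials Z (n * (M * e)))" if "\<alpha> \<in> E" for \<alpha>
  proof -
    have "(g * y i) ^ \<alpha> i * g ^ (M - \<alpha> i) \<in> poly_values Z (M * e)" if "i < n" for i
    proof -
      have "\<alpha> i < M" using \<open>\<alpha> \<in> E\<close> that by (auto simp: E_def PiE_def Pi_def)
      then have "\<alpha> i * e + (M - \<alpha> i) * e = M * e" by (metis add_mult_distrib le_add_diff_inverse less_imp_le)
      then show ?thesis using poly_values_mult[OF poly_values_power[OF g(3)[OF that]] poly_values_power[OF g(2)], of "\<alpha> i" "M - \<alpha> i"]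
        by simp
    qed
    then have "(\<Prod>i<n. (g * y i) ^ \<alpha> i * g ^ (M - \<alpha> i)) \<in> poly_values Z (n * (M * e))"
      by (rule poly_values_prod)
    also have "(\<Prod>i<n. (g * y i) ^ \<alpha> i * g ^ (M - \<alpha> i)) = (\<Prod>i<n. g ^ M * y i ^ \<alpha> i)"
    proof (rule prod.cong)
      fix i assume "i \<in> {..<n}"
      then have "\<alpha> i < M" using \<open>\<alpha> \<in> E\<close> by (auto simp: E_def PiE_def Pi_def)
      then have "g ^ \<alpha> i * g ^ (M - \<alpha> i) = g ^ M" by (simp flip: power_add)
      then show "(g * y i) ^ \<alpha> i * g ^ (M - \<alpha> i) = g ^ M * y i ^ \<alpha> i"
        by (simp add: power_mult_distrib mult_ac)
    qed simp
    also have "\<dots> = G * mon \<alpha>" by (simp add: prod.distrib G_def mon_def power_mult power_commutes flip: power_mult) (simp add: mult.commute)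
    finally have "G * mon \<alpha> \<in> Q.span (monomials Z (n * (M * e)))" by (simp add: poly_values_def)
    moreover have "x / G \<in> Q.span ((\<lambda>t. t / G) ` B)" if "x \<in> Q.span B" for x B
      using that
    proof (induction rule: Q.span_induct_alt)
      case base then show ?case by (simp add: Q.span_zero)
    next
      case (step c x z)
      have "x / G \<in> Q.span ((\<lambda>t. t / G) ` B)" using step.hyps by (auto intro: Q.span_base)
      from Q.span_add[OF Q.span_scale[OF this, of c] step.IH] show ?case by (simp add: add_divide_distrib)
    qed
    ultimately show ?thesis using g(1) by (metis G_def nonzero_mult_div_cancel_left power_not_zero)
  qed
  then have "card (mon ` E) \<le> card ((\<lambda>t. t / G) ` monomials Z (n * (M * e)))"
    using Q.independent_span_bound[OF _ indep] card_monomials[OF Z] by blast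
  also have "\<dots> \<le> (n * (M * e) + 1) ^ card Z"
    using card_monomials[OF Z] card_image_le le_trans by blast
  also have "\<dots> \<le> ((n * e + 1) * M) ^ card Z"
    by (rule power_mono) (auto simp: M_def algebra_simps)
  also have "\<dots> = (n * e + 1) ^ card Z * M ^ card Z" by (rule power_mult_distrib)
  also have "\<dots> < M * M ^ card Z" by (simp add: M_def)
  also have "\<dots> \<le> M ^ n" using \<open>\<not> n \<le> card Z\<close>
    using power_increasing[of "Suc (card Z)" n M] by (simp add: M_def)
  also have "M ^ n = card (mon ` E)" by (simp add: card_image[OF inj]) (simp add: E_def card_PiE)
  finally show False by simp
qed

text \<open>
  The missing terms among the first \<open>n\<close> can be added to the generators at the cost of one each.
\<close>

lemma generic_card_le:
  assumes y: "generic y" and "finite I" and Z: "finite Z" and sub: "y ` I \<subseteq> field_gen Z"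
  shows "card I \<le> card Z"
proof -
  obtain n where n: "I \<subseteq> {..<n}" using \<open>finite I\<close> by (meson finite_nat_iff_bounded)
  let ?Z = "Z \<union> y ` ({..<n} - I)"
  have "y ` {..<n} \<subseteq> field_gen ?Z"
    using sub field_gen_mono[of Z ?Z] by (auto intro: field_gen.gen)
  then have "n \<le> card ?Z" using generic_initial_le_card[OF y, of ?Z n] Z by simp
  also have "\<dots> \<le> card Z + card (y ` ({..<n} - I))" by (rule card_Un_le)
  also have "\<dots> \<le> card Z + (n - card I)"
    using card_image_le[of "{..<n} - I" y] card_Diff_subset[OF \<open>finite I\<close> n] by simp
  finally show ?thesis using card_mono[OF _ n] by simp
qed

section \<open>The inner product\<close>

lemma Rd_iff: "x \<in> Rd d \<longleftrightarrow> (\<forall>i\<ge>d. x i = 0)"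
  by (simp add: topspace_Euclidean_space)

lemma scaleR_fun_apply [simp]: "(c *\<^sub>R f) x = c *\<^sub>R f x"
  by (simp add: scaleR_fun_def)

lemma sum_fun_apply: "(\<Sum>i\<in>A. f i) x = (\<Sum>i\<in>A. f i x)"
  for f :: "'i \<Rightarrow> 'x \<Rightarrow> 'a::comm_monoid_add"
  by (induction A rule: infinite_finite_induct) auto

lemma subspace_Rd: "subspace (Rd d)"
  by (auto simp: subspace_def Rd_iff)

lemma ip_commute: "ip d x y = ip d y x"
  by (simp add: ip_def mult.commute)

lemma ip_add_left: "ip d (x + y) z = ip d x z + ip d y z"
  by (simp add: ip_def algebra_simps sum.distrib)

lemma ip_diff_left: "ip d (x - y) z = ip d x z - ip d y z"
  by (simp add: ip_def algebra_simps sum_subtractf)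

lemma ip_scaleR_left: "ip d (c *\<^sub>R x) z = c * ip d x z"
  by (simp add: ip_def algebra_simps sum_distrib_left)

lemma ip_zero_left: "ip d 0 z = 0"
  by (simp add: ip_def)

lemma ip_self_eq_0: "ip d x x = 0 \<longleftrightarrow> (\<forall>i<d. x i = 0)"
  by (simp add: ip_def sum_nonneg_eq_0_iff Ball_def)

lemma ip_span_left: "x \<in> span A \<Longrightarrow> (\<And>a. a \<in> A \<Longrightarrow> ip d a u = 0) \<Longrightarrow> ip d x u = 0"
  by (induction rule: span_induct_alt) (auto simp: ip_add_left ip_scaleR_left ip_zero_left)

text \<open>
  Gram-Schmidt orthogonalisation, one vector at a time.  The form \<open>ip d\<close> is only semidefinite on
  functions \<open>nat \<Rightarrow> real\<close>; a vector of length zero is orthogonal to everything, so this does no harm.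
\<close>

lemma exists_orthogonal_projection:
  assumes "finite A"
  shows "\<exists>y\<in>span A. \<forall>a\<in>A. ip d (u - y) a = 0"
  using assms
proof (induction A arbitrary: u rule: finite_induct)
  case empty
  then show ?case by (auto simp: span_zero)
next
  case (insert a A)
  obtain z where z: "z \<in> span A" "\<And>b. b \<in> A \<Longrightarrow> ip d (a - z) b = 0" using insert.IH by blast
  obtain y0 where y0: "y0 \<in> span A" "\<And>b. b \<in> A \<Longrightarrow> ip d (u - y0) b = 0" using insert.IH by blast
  define a' where "a' = a - z"
  have sub: "span A \<subseteq> span (insert a A)" by (intro span_mono) auto
  have *: "ip d x a = ip d x a'" if "\<And>b. b \<in> A \<Longrightarrow> ip d x b = 0" for x
  proof -
    have "ip d z x = 0" using z(1) by (rule ip_span_left) (metis ip_commute that)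
    then show ?thesis unfolding a'_def by (metis ip_commute ip_diff_left diff_zero)
  qed
  show ?case
  proof (cases "ip d a' a' = 0")
    case True
    then have "ip d (u - y0) a' = 0" by (simp add: ip_self_eq_0) (simp add: ip_def)
    then have "ip d (u - y0) a = 0" using *[of "u - y0"] y0(2) by simp
    then show ?thesis using y0 sub by blast
  next
    case False
    define y where "y = y0 + (ip d (u - y0) a' / ip d a' a') *\<^sub>R a'"
    have eq: "ip d (u - y) b = ip d (u - y0) b - ip d (u - y0) a' / ip d a' a' * ip d a' b" for b
      by (simp add: y_def ip_diff_left ip_add_left ip_scaleR_left)
    have 1: "ip d (u - y) b = 0" if "b \<in> A" for b
      unfolding eq using y0(2)[OF that] z(2)[OF that] by (simp add: a'_def)
    have "ip d (u - y) a = ip d (u - y) a'" using 1 by (rule *)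
    also have "\<dots> = 0" unfolding eq using False by simp
    finally have "\<forall>b\<in>insert a A. ip d (u - y) b = 0" using 1 by simp
    moreover have "y \<in> span (insert a A)" unfolding y_def a'_def
      by (intro span_add span_scale span_diff subsetD[OF sub] y0(1) z(1) span_base) simp
    ultimately show ?thesis by blast
  qed
qed

section \<open>Parameters of a family of orthogonal vectors\<close>

definition vectors_over :: "real set \<Rightarrow> (nat \<Rightarrow> real) set" where
  "vectors_over X = {x. range x \<subseteq> field_gen X}"

lemma vectors_over_iff: "x \<in> vectors_over X \<longleftrightarrow> (\<forall>i. x i \<in> field_gen X)"
  by (auto simp: vectors_over_def)

lemma vectors_over_mono: "X \<subseteq> Y \<Longrightarrow> vectors_over X \<subseteq> vectors_over Y"
  using field_gen_mono[of X Y] by (auto simp: vectors_over_def)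

lemma ip_in_field_gen: "x \<in> vectors_over X \<Longrightarrow> y \<in> vectors_over X \<Longrightarrow> ip d x y \<in> field_gen X"
  by (auto simp: ip_def vectors_over_iff intro!: field_gen_sum field_gen.mult)

text \<open>
  The subspace of \<open>span W\<close> cut out by orthogonality to the \<open>u r\<close> is still spanned by vectors over the
  same field, and each \<open>u r\<close> outside the span of its predecessors lowers the number of spanning vectors
  by one.  Imposing orthogonality to \<open>u b\<close> on \<open>span T\<close> is elimination with a pivot \<open>t0\<close>.  If there is no
  pivot, then \<open>u b\<close> is orthogonal to all of \<open>span T\<close>; as its component orthogonal to the earlier vectors
  lies in \<open>span T\<close>, this component is zero and \<open>u b\<close> depends on them.
\<close>

lemma rational_basis_orthogonal_part:
  fixes N :: "nat set"
  assumes W: "finite W" "W \<subseteq> Rd d" "W \<subseteq> vectors_over X" and "finite N"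
    and "\<And>r. r \<in> N \<Longrightarrow> u r \<in> span W" "\<And>r. r \<in> N \<Longrightarrow> u r \<in> vectors_over X"
  shows "\<exists>T. finite T \<and> T \<subseteq> vectors_over X \<and> {x \<in> span W. \<forall>r\<in>N. ip d x (u r) = 0} \<subseteq> span T \<and>
    card T + card {r\<in>N. u r \<notin> span (u ` {q\<in>N. q < r})} \<le> card W"
  using assms(4-)
proof (induction N rule: finite_linorder_max_induct)
  case empty
  show ?case using W by (intro exI[of _ W]) auto
next
  case (insert b N)
  then obtain T where T: "finite T" "T \<subseteq> vectors_over X" "{x \<in> span W. \<forall>r\<in>N. ip d x (u r) = 0} \<subseteq> span T"
    "card T + card {r\<in>N. u r \<notin> span (u ` {q\<in>N. q < r})} \<le> card W" by auto
  have b: "u b \<in> span W" "u b \<in> vectors_over X" using insert.prems by auto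
  define I where "I = {r\<in>N. u r \<notin> span (u ` {q\<in>N. q < r})}"
  have "finite I" using insert.hyps by (simp add: I_def)
  have I': "{r\<in>insert b N. u r \<notin> span (u ` {q\<in>insert b N. q < r})} =
    I \<union> (if u b \<in> span (u ` N) then {} else {b})" (is "?I' = _")
  proof -
    have 1: "{q\<in>insert b N. q < b} = N" using insert.hyps(2) by auto
    have 2: "{q\<in>insert b N. q < r} = {q\<in>N. q < r}" if "r \<in> N" for r
      using insert.hyps(2) that by force
    have "b \<notin> N" using insert.hyps(2) by auto
    have "r \<in> ?I' \<longleftrightarrow> r \<in> I \<union> (if u b \<in> span (u ` N) then {} else {b})" for r
    proof (cases "r = b")
      case True
      then have "r \<in> ?I' \<longleftrightarrow> u b \<notin> span (u ` N)" unfolding mem_Collect_eq by (simp only: 1 insertI1 simp_thms)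
      then show ?thesis using True \<open>b \<notin> N\<close> by (simp add: I_def)
    next
      case False
      then have "r \<in> ?I' \<longleftrightarrow> r \<in> N \<and> u r \<notin> span (u ` {q\<in>insert b N. q < r})" by blast
      also have "\<dots> \<longleftrightarrow> r \<in> I"
        unfolding I_def mem_Collect_eq by (rule conj_cong[OF refl]) (simp only: 2)
      finally show ?thesis using False by simp
    qed
    then show ?thesis by blast
  qed
  show ?case
  proof (cases "\<exists>t0\<in>T. ip d t0 (u b) \<noteq> 0")
    case True
    then obtain t0 where t0: "t0 \<in> T" "ip d t0 (u b) \<noteq> 0" by blast
    define \<phi> where "\<phi> t = t - (ip d t (u b) / ip d t0 (u b)) *\<^sub>R t0" for t
    let ?T = "\<phi> ` (T - {t0})"
    have "?T \<subseteq> vectors_over X"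
    proof (rule image_subsetI)
      fix t assume "t \<in> T - {t0}"
      then have "t \<in> vectors_over X" "t0 \<in> vectors_over X" using T(2) t0 by auto
      then show "\<phi> t \<in> vectors_over X"
        using b ip_in_field_gen[of _ X "u b" d]
        by (auto simp: \<phi>_def vectors_over_iff intro!: field_gen.diff field_gen.mult field_gen_divide)
    qed
    moreover have "{x \<in> span W. \<forall>r\<in>insert b N. ip d x (u r) = 0} \<subseteq> span ?T"
    proof
      fix x assume "x \<in> {x \<in> span W. \<forall>r\<in>insert b N. ip d x (u r) = 0}"
      then have x: "x \<in> span W" "\<forall>r\<in>insert b N. ip d x (u r) = 0" by simp_all
      then have "x \<in> span T" using T(3) by auto
      then have "\<phi> x \<in> span (\<phi> ` T)"
      proof (induction rule: span_induct_alt)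
        case base
        have "\<phi> 0 = 0" unfolding \<phi>_def by (simp only: ip_zero_left div_0 scaleR_zero_left diff_0_right)
        then show ?case by (metis span_zero)
      next
        case (step c x y)
        have "\<phi> (c *\<^sub>R x + y) = c *\<^sub>R \<phi> x + \<phi> y"
          unfolding \<phi>_def by (rule ext) (simp add: ip_add_left ip_scaleR_left algebra_simps add_divide_distrib)
        moreover have "\<phi> x \<in> span (\<phi> ` T)" using step.hyps by (intro span_base) simp
        ultimately show ?case using step.IH by (metis span_add span_scale)
      qed
      moreover have "\<phi> x = x" using x by (simp add: \<phi>_def)
      moreover have "\<phi> ` T \<subseteq> insert 0 ?T" using t0 by (auto simp: \<phi>_def)
      ultimately show "x \<in> span ?T" using span_mono[of "\<phi> ` T" "insert 0 ?T"] by auto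
    qed
    moreover have "card ?T + card ?I' \<le> card W"
    proof -
      have "card ?T + 1 \<le> card T" using T(1) t0(1)
        by (metis Suc_eq_plus1 card_Suc_Diff1 card_image_le finite_Diff Suc_le_mono)
      moreover have "card ?I' \<le> card I + 1"
        unfolding I' using card_Un_le[of I "{b}"] by simp
      ultimately show ?thesis using T(4) by (simp add: I_def)
    qed
    moreover have "finite ?T" using T(1) by simp
    ultimately show ?thesis by (intro exI[of _ ?T] conjI) assumption+
  next
    case False
    obtain y where y: "y \<in> span (u ` N)" "\<And>r. r \<in> N \<Longrightarrow> ip d (u b - y) (u r) = 0"
      using exists_orthogonal_projection[of "u ` N" d "u b"] insert.hyps(1) by auto
    have "span (u ` N) \<subseteq> span W" using insert.prems by (intro span_minimal) auto
    then have diff: "u b - y \<in> span W" using b y by (intro span_diff) auto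
    then have "u b - y \<in> span T" using T(3) y by auto
    then have 1: "ip d (u b - y) (u b) = 0" by (rule ip_span_left) (use False in blast)
    have "ip d y (u b - y) = 0" using y(1) by (rule ip_span_left) (metis image_iff ip_commute y(2))
    then have "ip d (u b - y) y = 0" by (simp add: ip_commute)
    with 1 have "ip d (u b - y) (u b - y) = 0"
      by (metis ip_commute ip_diff_left diff_self)
    moreover have "u b - y \<in> Rd d" using diff span_minimal[OF W(2) subspace_Rd] by blast
    ultimately have "u b = y"
      by (auto simp: ip_self_eq_0 Rd_iff fun_eq_iff) (metis eq_iff_diff_eq_0 not_le)
    with y(1) have "?I' = I" unfolding I' by simp
    then have "card T + card ?I' \<le> card W" using T(4) by (simp only: I_def)
    moreover have "{x \<in> span W. \<forall>r\<in>insert b N. ip d x (u r) = 0} \<subseteq> span T" using T(3) by blast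
    ultimately show ?thesis using T(1,2) by (intro exI[of _ T] conjI) assumption+
  qed
qed

text \<open>
  A vector in the span of \<open>T\<close> is given by \<open>card T\<close> coefficients; normalising one of its entries to 1
  determines one coefficient from the others.
\<close>

lemma normalised_span_parameters:
  assumes T: "finite T" "T \<subseteq> vectors_over X" and x: "x \<in> span T" "x e = 1"
  shows "\<exists>C. finite C \<and> card C < card T \<and> x \<in> vectors_over (X \<union> C)"
proof -
  obtain c where c: "x = (\<Sum>t\<in>T. c t *\<^sub>R t)" using x(1) span_finite[OF T(1)] by auto
  then have xe: "x i = (\<Sum>t\<in>T. c t * t i)" for i by (simp add: sum_fun_apply)
  have "\<exists>t0\<in>T. t0 e \<noteq> 0"
  proof (rule ccontr)
    assume "\<not> ?thesis"
    then have "x e = 0" unfolding xe by (intro sum.neutral) simp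
    then show False using x(2) by simp
  qed
  then obtain t0 where t0: "t0 \<in> T" "t0 e \<noteq> 0" by blast
  define C where "C = c ` (T - {t0})"
  have c': "c t \<in> field_gen (X \<union> C)" if "t \<in> T - {t0}" for t using that by (auto simp: C_def intro: field_gen.gen)
  have t: "t i \<in> field_gen (X \<union> C)" if "t \<in> T" for t i
    using that T(2) vectors_over_mono[of X "X \<union> C"] by (auto simp: vectors_over_iff)
  have "c t0 * t0 e = x e - (\<Sum>t\<in>T - {t0}. c t * t e)"
    unfolding xe using T(1) t0 by (simp add: sum.remove[of _ t0])
  then have "c t0 = (1 - (\<Sum>t\<in>T - {t0}. c t * t e)) / t0 e" using t0 x(2) by (simp add: field_simps)
  also have "\<dots> \<in> field_gen (X \<union> C)"
    using c' t by (intro field_gen_divide[OF _ t[OF t0(1)]] field_gen.diff field_gen.one field_gen_sum field_gen.mult) auto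
  finally have "c t \<in> field_gen (X \<union> C)" if "t \<in> T" for t using c' that by (cases "t = t0") auto
  then have "x \<in> vectors_over (X \<union> C)" using t unfolding vectors_over_iff xe by (intro allI field_gen_sum field_gen.mult) auto
  moreover have "card C < card T"
    using T(1) t0(1) card_image_le[of "T - {t0}" c] card_Diff1_less[of T t0] by (simp add: C_def)
  moreover have "finite C" using T(1) by (simp add: C_def)
  ultimately show ?thesis by blast
qed

lemma Rd_unit_vectors:
  "(\<lambda>l i. if i = l then 1 else 0::real) ` {..<d} \<subseteq> Rd d \<inter> vectors_over X" (is "?W \<subseteq> _")
  "Rd d \<subseteq> span ((\<lambda>l i. if i = l then 1 else 0::real) ` {..<d})"
proof -
  show "?W \<subseteq> Rd d \<inter> vectors_over X" by (auto simp: Rd_iff vectors_over_iff field_gen_zero field_gen.one)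
  show "Rd d \<subseteq> span ?W"
  proof
    fix x assume x: "x \<in> Rd d"
    have "x = (\<Sum>l<d. x l *\<^sub>R (\<lambda>i. if i = l then 1 else 0))"
    proof
      fix i
      have "(\<Sum>l<d. x l *\<^sub>R (\<lambda>i. if i = l then 1 else 0)) i = (\<Sum>l<d. if i = l then x l else 0)"
        unfolding sum_fun_apply by (intro sum.cong) auto
      then show "x i = (\<Sum>l<d. x l *\<^sub>R (\<lambda>i. if i = l then 1 else 0)) i"
        using x by (simp add: Rd_iff)
    qed
    also have "\<dots> \<in> span ?W" by (intro span_sum span_scale span_base) auto
    finally show "x \<in> span ?W" .
  qed
qed

text \<open>
  Discarding every vector that depends on its predecessors does not change the span.
\<close>

lemma span_independent_indices:
  fixes v :: "nat \<Rightarrow> 'a::real_vector"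
  shows "v ` {1..s} \<subseteq> span (v ` ({1..s} - {t\<in>{1..s}. v t \<in> span (v ` {1..<t})}))" (is "_ \<subseteq> span ?W")
proof -
  have "v t \<in> span ?W" if "t \<in> {1..s}" for t
    using that
  proof (induction t rule: less_induct)
    case (less t)
    show ?case
    proof (cases "v t \<in> span (v ` {1..<t})")
      case True
      moreover have "span (v ` {1..<t}) \<subseteq> span ?W" using less by (intro span_minimal) auto
      ultimately show ?thesis by blast
    next
      case False
      with less show ?thesis by (intro span_base) auto
    qed
  qed
  then show ?thesis by auto
qed

text \<open>
  Each orthogonality relation saves a parameter.  The vectors are added in order.  Let \<open>Dp s\<close> be the set
  of the first \<open>s\<close> indices whose vector depends on its predecessors.  A constraint of a new vector is
  wasted only if it comes from an index in \<open>Dp s\<close>, so at most \<open>card (Dp s)\<close> parameters are lost in step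
  \<open>s + 1\<close>.  On the other hand a vector that joins \<open>Dp\<close> in step \<open>s + 1\<close> ranges over a space of dimension
  \<open>s - card (Dp s)\<close> instead of \<open>d\<close>.  The induction invariant keeps this gain as a credit of \<open>d + 1 - s\<close>
  per element of \<open>Dp s\<close>, of which each step consumes one unit per element; since \<open>s \<le> k \<le> d\<close> the credit
  never runs out.
\<close>

lemma orthogonal_family_parameters:
  assumes "k \<le> d" and v: "\<And>i. i \<in> {1..k} \<Longrightarrow> v i \<in> Rd d" "\<And>i. i \<in> {1..k} \<Longrightarrow> v i (e i) = 1"
    and orth: "\<And>r s. (r, s) \<in> \<O> \<Longrightarrow> ip d (v r) (v s) = 0"
    and \<O>: "\<O> \<subseteq> {(r, s). 1 \<le> r \<and> r < s \<and> s \<le> k}"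
  shows "\<exists>X. finite X \<and> card X + card \<O> \<le> k * (d - 1) \<and> (\<forall>i\<in>{1..k}. v i \<in> vectors_over X)"
proof -
  define Dp where "Dp s = {t\<in>{1..s}. v t \<in> span (v ` {1..<t})}" for s
  have fin: "finite \<O>"
    by (rule finite_subset[OF \<O>]) (rule finite_subset[of _ "{..k} \<times> {..k}"], auto)
  have "\<exists>X. finite X \<and> (\<forall>i\<in>{1..s}. v i \<in> vectors_over X) \<and>
      card X + card {p\<in>\<O>. snd p \<le> s} + card (Dp s) * (d + 1 - s) \<le> s * (d - 1)" if "s \<le> k" for s
    using that
  proof (induction s)
    case 0
    have "{p\<in>\<O>. snd p \<le> 0} = {}" using \<O> by auto
    then show ?case by (intro exI[of _ "{}"], simp only: Dp_def) simp
  next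
    case (Suc s)
    then obtain X where X: "finite X" "\<And>i. i \<in> {1..s} \<Longrightarrow> v i \<in> vectors_over X"
      "card X + card {p\<in>\<O>. snd p \<le> s} + card (Dp s) * (d + 1 - s) \<le> s * (d - 1)" by auto
    define N where "N = {r. (r, Suc s) \<in> \<O>}"
    define I where "I = {r\<in>N. v r \<notin> span (v ` {q\<in>N. q < r})}"
    have N: "N \<subseteq> {1..s}" using \<O> by (auto simp: N_def)
    then have "finite N" by (rule finite_subset) simp
    have "card N \<le> card I + card (Dp s)"
    proof -
      have "N \<subseteq> I \<union> Dp s"
      proof
        fix r assume "r \<in> N"
        then have "span (v ` {q\<in>N. q < r}) \<subseteq> span (v ` {1..<r})" using N by (intro span_mono) auto
        with \<open>r \<in> N\<close> N show "r \<in> I \<union> Dp s" by (auto simp: I_def Dp_def)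
      qed
      moreover have "finite (I \<union> Dp s)" using \<open>finite N\<close> by (auto simp: I_def Dp_def)
      ultimately show ?thesis by (meson card_Un_le card_mono le_trans)
    qed
    have "{p\<in>\<O>. snd p \<le> Suc s} = {p\<in>\<O>. snd p \<le> s} \<union> (\<lambda>r. (r, Suc s)) ` N"
      by (auto simp: N_def le_Suc_eq)
    moreover have "card ({p\<in>\<O>. snd p \<le> s} \<union> (\<lambda>r. (r, Suc s)) ` N) =
        card {p\<in>\<O>. snd p \<le> s} + card ((\<lambda>r. (r, Suc s)) ` N)"
      using fin \<open>finite N\<close> by (intro card_Un_disjoint) auto
    moreover have "card ((\<lambda>r. (r, Suc s)) ` N) = card N" by (rule card_image) (auto simp: inj_on_def)
    ultimately have cO: "card {p\<in>\<O>. snd p \<le> Suc s} = card {p\<in>\<O>. snd p \<le> s} + card N"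
      by simp
    \<comment> \<open>The new vector may be sought in the span of any \<open>W\<close> that contains it and its constraints;
      the two cases below differ only in the choice of \<open>W\<close>.\<close>
    have params: "\<exists>C. finite C \<and> v (Suc s) \<in> vectors_over (X \<union> C) \<and> card C + 1 + card I \<le> card W"
      if W: "finite W" "W \<subseteq> Rd d" "W \<subseteq> vectors_over X" and NW: "\<And>r. r \<in> N \<Longrightarrow> v r \<in> span W"
        and vW: "v (Suc s) \<in> span W" for W
    proof -
      have "\<And>r. r \<in> N \<Longrightarrow> v r \<in> vectors_over X" using N X(2) by auto
      from rational_basis_orthogonal_part[where u = v, OF W \<open>finite N\<close> NW this]
      obtain T where T: "finite T" "T \<subseteq> vectors_over X" "{x \<in> span W. \<forall>r\<in>N. ip d x (v r) = 0} \<subseteq> span T"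
        "card T + card I \<le> card W" by (auto simp: I_def)
      have "ip d (v (Suc s)) (v r) = 0" if "r \<in> N" for r
        using orth[of r "Suc s"] that by (simp add: N_def ip_commute)
      with vW T(3) have "v (Suc s) \<in> span T" by auto
      from normalised_span_parameters[OF T(1,2) this v(2)] Suc.prems
      obtain C where "finite C" "card C < card T" "v (Suc s) \<in> vectors_over (X \<union> C)" by auto
      with T(4) show ?thesis by (intro exI[of _ C]) auto
    qed
    have rv: "\<forall>i\<in>{1..Suc s}. v i \<in> vectors_over (X \<union> C)" if "v (Suc s) \<in> vectors_over (X \<union> C)" for C
    proof
      fix i assume "i \<in> {1..Suc s}"
      then have "i = Suc s \<or> i \<in> {1..s}" by auto
      then show "v i \<in> vectors_over (X \<union> C)" using that X(2) vectors_over_mono[of X "X \<union> C"] by blast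
    qed
    obtain \<delta> where \<delta>: "d = Suc (s + \<delta>)" using Suc.prems \<open>k \<le> d\<close>
      by (intro that[of "d - s - 1"]) auto
    have "card (Dp s) \<le> card {1..s}" by (rule card_mono) (auto simp: Dp_def)
    show ?case
    proof (cases "v (Suc s) \<in> span (v ` {1..<Suc s})")
      case True
      define W where "W = v ` ({1..s} - Dp s)"
      have sp: "v ` {1..s} \<subseteq> span W" unfolding W_def Dp_def by (rule span_independent_indices[of v s])
      have "span (v ` {1..<Suc s}) \<subseteq> span W" using sp by (intro span_minimal) (auto simp: image_subset_iff)
      then have vW: "v (Suc s) \<in> span W" using True by blast
      have W: "finite W" "W \<subseteq> Rd d" "W \<subseteq> vectors_over X" using v(1) X(2) Suc.prems by (auto simp: W_def)
      have NW: "v r \<in> span W" if "r \<in> N" for r using that N sp by blast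
      obtain C where C: "finite C" "v (Suc s) \<in> vectors_over (X \<union> C)" "card C + 1 + card I \<le> card W"
        using params[OF W NW vW] by blast
      have "card W \<le> card ({1..s} - Dp s)" unfolding W_def by (rule card_image_le) simp
      also have "\<dots> = s - card (Dp s)" by (subst card_Diff_subset) (auto simp: Dp_def)
      finally have "card W + card (Dp s) \<le> s" using \<open>card (Dp s) \<le> card {1..s}\<close> by simp
      have "Dp (Suc s) = insert (Suc s) (Dp s)" using True by (auto simp: Dp_def le_Suc_eq)
      moreover have "Suc s \<notin> Dp s" "finite (Dp s)" by (auto simp: Dp_def)
      ultimately have "card (Dp (Suc s)) = card (Dp s) + 1" by simp
      moreover have "card (X \<union> C) \<le> card X + card C" by (rule card_Un_le)
      ultimately have "card (X \<union> C) + card {p\<in>\<O>. snd p \<le> Suc s} + card (Dp (Suc s)) * (d + 1 - Suc s) \<le> Suc s * (d - 1)"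
        using cO X(3) C(3) \<open>card W + card (Dp s) \<le> s\<close> \<open>card N \<le> card I + card (Dp s)\<close> \<delta>
        by (simp add: algebra_simps)
      with C X(1) rv[of C] show ?thesis by (intro exI[of _ "X \<union> C"]) simp
    next
      case False
      define W where "W = (\<lambda>l i. if i = l then 1 else 0::real) ` {..<d}"
      have W: "finite W" "W \<subseteq> Rd d" "W \<subseteq> vectors_over X" "Rd d \<subseteq> span W" "card W \<le> d"
        using Rd_unit_vectors(1)[of d X] Rd_unit_vectors(2)[of d] card_image_le[of "{..<d}"] by (auto simp: W_def)
      have NW: "v r \<in> span W" if "r \<in> N" for r
      proof -
        have "r \<in> {1..k}" using that N Suc.prems by force
        then show ?thesis using v(1) W(4) by blast
      qed
      have vW: "v (Suc s) \<in> span W" using v(1)[of "Suc s"] W(4) Suc.prems by auto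
      obtain C where C: "finite C" "v (Suc s) \<in> vectors_over (X \<union> C)" "card C + 1 + card I \<le> card W"
        using params[OF W(1-3) NW vW] by blast
      have "Dp (Suc s) = Dp s" using False by (auto simp: Dp_def le_Suc_eq)
      moreover have "card (X \<union> C) \<le> card X + card C" by (rule card_Un_le)
      ultimately have "card (X \<union> C) + card {p\<in>\<O>. snd p \<le> Suc s} + card (Dp (Suc s)) * (d + 1 - Suc s) \<le> Suc s * (d - 1)"
        using cO X(3) C(3) W(5) \<open>card N \<le> card I + card (Dp s)\<close> \<delta>
        by (simp add: algebra_simps)
      with C X(1) rv[of C] show ?thesis by (intro exI[of _ "X \<union> C"]) simp
    qed
  qed
  from this[of k] obtain X where "finite X" "\<forall>i\<in>{1..k}. v i \<in> vectors_over X" "card X + card {p\<in>\<O>. snd p \<le> k} \<le> k * (d - 1)"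
    by auto
  moreover have "{p\<in>\<O>. snd p \<le> k} = \<O>" using \<O> by auto
  ultimately show ?thesis by auto
qed

section \<open>Incidences of generic points with hyperplanes\<close>

definition generic_point :: "nat \<Rightarrow> (nat \<Rightarrow> real) \<Rightarrow> nat \<Rightarrow> nat \<Rightarrow> real" where
  "generic_point d y j = (\<lambda>l. if l < d then y (j * d + l) else 0)"

lemma generic_point_in_Rd: "generic_point d y j \<in> Rd d"
  by (simp add: generic_point_def Rd_iff)

lemma inj_block_index: "inj_on (\<lambda>(j, l). j * d + l) (UNIV \<times> {..<d::nat})"
proof (rule inj_onI, clarify)
  fix j l j' l' assume "j * d + l = j' * d + l'" "l < d" "l' < d"
  then have "(j * d + l) div d = (j' * d + l') div d" "(j * d + l) mod d = (j' * d + l') mod d" by simp_all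
  with \<open>l < d\<close> \<open>l' < d\<close> show "j = j' \<and> l = l'" by simp
qed

lemma card_block_index:
  fixes d :: nat
  assumes "\<And>j l. (j, l) \<in> S \<Longrightarrow> l < d"
  shows "card ((\<lambda>(j, l). j * d + l) ` S) = card S"
  by (rule card_image, rule inj_on_subset[OF inj_block_index]) (use assms in auto)

text \<open>
  The equation of the hyperplane through the \<open>j\<close>-th point, whose normal vector has entry 1 at position
  \<open>e (c j)\<close>, expresses that coordinate of the point by the others.  So the generators \<open>X\<close> of the normal
  vectors, the \<open>k\<close> offsets and \<open>d - 1\<close> coordinates of each point generate all \<open>card S * d\<close> coordinates.
\<close>

lemma card_incidences_le:
  assumes y: "generic y" and S: "finite S" and X: "finite X"
    and c: "\<And>j. j \<in> S \<Longrightarrow> c j \<in> {1..k}" "\<And>j. j \<in> S \<Longrightarrow> ip d (generic_point d y j) (v (c j)) = b (c j)"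
    and v: "\<And>i. i \<in> {1..k} \<Longrightarrow> v i \<in> vectors_over X" "\<And>i. i \<in> {1..k} \<Longrightarrow> e i < d" "\<And>i. i \<in> {1..k} \<Longrightarrow> v i (e i) = 1"
  shows "card S \<le> card X + k"
proof (cases "S = {}")
  case False
  then obtain j0 where "j0 \<in> S" by blast
  then have d: "d \<ge> 1" using v(2) c(1) by fastforce
  define J where "J = (SIGMA j:S. {..<d} - {e (c j)})"
  define Z where "Z = X \<union> b ` {1..k} \<union> (\<lambda>(j, l). y (j * d + l)) ` J"
  have "finite J" using S by (auto simp: J_def)
  have Z: "x \<in> field_gen Z" if "x \<in> X \<or> x \<in> b ` {1..k} \<or> x \<in> (\<lambda>(j, l). y (j * d + l)) ` J" for x
    using that by (auto simp: Z_def intro: field_gen.gen)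
  have vZ: "v i l \<in> field_gen Z" if "i \<in> {1..k}" for i l
  proof -
    have "X \<subseteq> Z" by (auto simp: Z_def)
    then have "v i \<in> vectors_over Z" using v(1)[OF that] vectors_over_mono by blast
    then show ?thesis by (simp add: vectors_over_iff)
  qed
  have other: "y (j * d + l) \<in> field_gen Z" if "j \<in> S" "l < d" "l \<noteq> e (c j)" for j l
  proof -
    have "(j, l) \<in> J" using that by (auto simp: J_def)
    then show ?thesis by (intro Z) force
  qed
  have "y (j * d + e (c j)) \<in> field_gen Z" if j: "j \<in> S" for j
  proof -
    let ?e = "e (c j)"
    have e: "?e < d" "v (c j) ?e = 1" using v(2,3) c(1) j by blast+
    have "b (c j) = (\<Sum>l<d. y (j * d + l) * v (c j) l)"
      using c(2)[OF j] by (simp add: ip_def generic_point_def)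
    also have "\<dots> = y (j * d + ?e) + (\<Sum>l\<in>{..<d} - {?e}. y (j * d + l) * v (c j) l)"
      using e by (subst sum.remove[of _ ?e]) auto
    finally have "y (j * d + ?e) = b (c j) - (\<Sum>l\<in>{..<d} - {?e}. y (j * d + l) * v (c j) l)" by simp
    also have "\<dots> \<in> field_gen Z"
    proof (intro field_gen.diff field_gen_sum field_gen.mult vZ[OF c(1)[OF j]])
      show "b (c j) \<in> field_gen Z" using c(1)[OF j] by (intro Z) auto
    qed (use other[OF j] in auto)
    finally show ?thesis .
  qed
  with other have all: "y (j * d + l) \<in> field_gen Z" if "j \<in> S" "l < d" for j l
    using that by (cases "l = e (c j)") auto
  let ?I = "(\<lambda>(j, l). j * d + l) ` (S \<times> {..<d})"
  have "card ?I \<le> card Z"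
  proof (rule generic_card_le[OF y])
    show "finite Z" using X \<open>finite J\<close> by (simp add: Z_def)
  qed (use S all in auto)
  also have "card ?I = card S * d"
    by (subst card_block_index) (auto simp: card_cartesian_product)
  also have "card Z \<le> card X + card (b ` {1..k}) + card ((\<lambda>(j, l). y (j * d + l)) ` J)"
    unfolding Z_def by (meson add_le_mono1 card_Un_le le_trans)
  also have "\<dots> \<le> card X + k + card J"
    using card_image_le[of "{1..k}" b] card_image_le[OF \<open>finite J\<close>, of "\<lambda>(j, l). y (j * d + l)"] by simp
  also have "card J = (\<Sum>j\<in>S. d - 1)"
    unfolding J_def using S v(2) c(1) by (subst card_SigmaI) (auto intro!: sum.cong simp: card_Diff_singleton)
  finally have "card S * d \<le> card X + k + card S * (d - 1)" by simp
  moreover have "card S * d = card S * (d - 1) + card S" using d by (cases d) auto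
  ultimately show ?thesis by simp
qed simp

text \<open>
  In a nontrivial relation one point is a combination of the others, so its \<open>d\<close> coordinates lie in
  the field generated by the other points and by \<open>card S - 1 < d\<close> coefficients.
\<close>

lemma generic_points_independent:
  assumes y: "generic y" and S: "finite S" "card S \<le> d"
    and sum0: "(\<Sum>j\<in>S. c j *\<^sub>R generic_point d y j) = 0" and i: "i \<in> S"
  shows "c i = 0"
proof (rule ccontr)
  assume "c i \<noteq> 0"
  define J where "J = (S - {i}) \<times> {..<d}"
  define Z where "Z = (\<lambda>(j, l). y (j * d + l)) ` J \<union> (\<lambda>j. c j / c i) ` (S - {i})"
  have "finite J" using S by (simp add: J_def)
  have other: "y (j * d + l) \<in> field_gen Z" if "j \<in> S" "l < d" "j \<noteq> i" for j l
    using that by (intro field_gen.gen) (force simp: Z_def J_def)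
  have cc: "c j / c i \<in> field_gen Z" if "j \<in> S" "j \<noteq> i" for j
    using that by (intro field_gen.gen) (force simp: Z_def)
  have "y (i * d + l) \<in> field_gen Z" if l: "l < d" for l
  proof -
    have "(\<Sum>j\<in>S. c j *\<^sub>R generic_point d y j) l = 0" using sum0 by simp
    then have "(\<Sum>j\<in>S. c j * y (j * d + l)) = 0"
      using l by (simp add: sum_fun_apply generic_point_def)
    then have "c i * y (i * d + l) = - (\<Sum>j\<in>S - {i}. c j * y (j * d + l))"
      using S(1) i by (simp add: sum.remove[of _ i])
    then have "y (i * d + l) = - ((\<Sum>j\<in>S - {i}. c j * y (j * d + l)) / c i)"
      using \<open>c i \<noteq> 0\<close> by (simp add: field_simps)
    also have "\<dots> = - (\<Sum>j\<in>S - {i}. (c j / c i) * y (j * d + l))"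
      by (simp add: sum_divide_distrib)
    also have "\<dots> \<in> field_gen Z"
      using other l cc by (intro field_gen_uminus field_gen_sum field_gen.mult) auto
    finally show ?thesis .
  qed
  with other have all: "y (j * d + l) \<in> field_gen Z" if "j \<in> S" "l < d" for j l
    using that by (cases "j = i") auto
  let ?I = "(\<lambda>(j, l). j * d + l) ` (S \<times> {..<d})"
  have "card ?I \<le> card Z"
  proof (rule generic_card_le[OF y])
    show "finite Z" using S \<open>finite J\<close> by (simp add: Z_def)
  qed (use S all in auto)
  also have "card ?I = card S * d"
    by (subst card_block_index) (auto simp: card_cartesian_product)
  also have "card Z \<le> card ((\<lambda>(j, l). y (j * d + l)) ` J) + card ((\<lambda>j. c j / c i) ` (S - {i}))"
    unfolding Z_def by (rule card_Un_le)
  also have "\<dots> \<le> card J + card (S - {i})"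
    using S(1) by (intro add_mono card_image_le \<open>finite J\<close>) auto
  also have "\<dots> = (card S - 1) * d + (card S - 1)"
    using S(1) i by (simp add: J_def card_cartesian_product)
  finally have "card S * d \<le> (card S - 1) * d + (card S - 1)" .
  moreover have "card S \<ge> 1" using S(1) i by (metis One_nat_def Suc_leI card_gt_0_iff empty_iff)
  ultimately show False using S(2) by (cases "card S") auto
qed

lemma inj_generic_point:
  assumes "generic y" "finite S" "card S \<le> d"
  shows "inj_on (generic_point d y) S"
proof (rule inj_onI, rule ccontr)
  fix i j assume *: "i \<in> S" "j \<in> S" "generic_point d y i = generic_point d y j" "i \<noteq> j"
  define c where "c l = (if l = i then 1 else if l = j then - 1 else 0 :: real)" for l
  have "(\<Sum>l\<in>S. c l *\<^sub>R generic_point d y l) = (\<Sum>l\<in>{i, j}. c l *\<^sub>R generic_point d y l)"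
    using * assms(2) by (intro sum.mono_neutral_right) (auto simp: c_def)
  also have "\<dots> = 0" using * by (simp add: c_def)
  finally have "c i = 0" using generic_points_independent[OF assms] * by blast
  then show False by (simp add: c_def)
qed

lemma affine_subspace_generic_points:
  assumes y: "generic y" and S: "finite S" "card S \<le> d"
  shows "affine_subspace d (card S) (affine hull (generic_point d y ` S))"
proof -
  have inj: "inj_on (generic_point d y) S" using assms by (rule inj_generic_point)
  have "independent (generic_point d y ` S)"
  proof
    assume "dependent (generic_point d y ` S)"
    then obtain u where u: "\<exists>v\<in>generic_point d y ` S. u v \<noteq> 0" "(\<Sum>v\<in>generic_point d y ` S. u v *\<^sub>R v) = 0"
      using dependent_finite[of "generic_point d y ` S"] S(1) by auto
    then have "(\<Sum>j\<in>S. u (generic_point d y j) *\<^sub>R generic_point d y j) = 0"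
      by (simp add: sum.reindex[OF inj])
    then have "u (generic_point d y j) = 0" if "j \<in> S" for j
      using generic_points_independent[OF y S, of "\<lambda>j. u (generic_point d y j)"] that by blast
    with u(1) show False by blast
  qed
  then have "\<not> affine_dependent (generic_point d y ` S)" using affine_dependent_imp_dependent by blast
  then show ?thesis unfolding affine_subspace_def
    using S(1) card_image[OF inj] generic_point_in_Rd by blast
qed

lemma unit_sphere_nonzero: "v \<in> unit_sphere d \<Longrightarrow> \<exists>l<d. v l \<noteq> 0"
  using ip_self_eq_0[of d v] by (auto simp: unit_sphere_def)

lemma unit_sphere_abs_le_1: "v \<in> unit_sphere d \<Longrightarrow> \<bar>v l\<bar> \<le> 1"
proof (cases "l < d")
  case True
  assume "v \<in> unit_sphere d"
  then have "(\<Sum>i<d. v i * v i) = 1" by (simp add: unit_sphere_def ip_def)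
  moreover have "v l * v l \<le> (\<Sum>i<d. v i * v i)"
    using True by (intro member_le_sum) auto
  ultimately show ?thesis using abs_square_le_1[of "v l"] by (simp add: power2_eq_square)
qed (auto simp: unit_sphere_def Rd_iff)

text \<open>
  Degrees of freedom: a family of \<open>k\<close> hyperplanes satisfying the relations \<open>\<O>\<close> contains at most
  \<open>k * d - card \<O>\<close> generic points.  Normal vectors are rescaled so that some entry \<open>e i\<close> becomes 1; this
  costs no square roots and keeps everything in the generated field.  The alternative \<open>\<O> = {}\<close> is kept
  because \<open>k \<le> d\<close> is itself derived from the count without orthogonality.
\<close>

lemma incidences_plus_orthogonality_le:
  assumes y: "generic y" and S: "finite S"
    and v: "\<And>i. i \<in> {1..k} \<Longrightarrow> v i \<in> unit_sphere d"
    and inc: "\<And>j. j \<in> S \<Longrightarrow> \<exists>i\<in>{1..k}. ip d (generic_point d y j) (v i) = b i"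
    and orth: "\<And>r s. (r, s) \<in> \<O> \<Longrightarrow> ip d (v r) (v s) = 0"
    and \<O>: "\<O> \<subseteq> {(r, s). 1 \<le> r \<and> r < s \<and> s \<le> k}"
    and kd: "\<O> = {} \<or> k \<le> d"
  shows "card S + card \<O> \<le> k * d"
proof (cases "k = 0")
  case True
  then have "S = {}" "\<O> = {}" using inc \<O> by auto
  then show ?thesis by simp
next
  case False
  obtain e where e: "\<And>i. i \<in> {1..k} \<Longrightarrow> e i < d" "\<And>i. i \<in> {1..k} \<Longrightarrow> v i (e i) \<noteq> 0"
    using unit_sphere_nonzero[OF v] by metis
  obtain c where c: "\<And>j. j \<in> S \<Longrightarrow> c j \<in> {1..k}" "\<And>j. j \<in> S \<Longrightarrow> ip d (generic_point d y j) (v (c j)) = b (c j)"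
    using inc by metis
  define v' where "v' i = (1 / v i (e i)) *\<^sub>R v i" for i
  define b' where "b' i = b i / v i (e i)" for i
  have v': "v' i \<in> Rd d" "v' i (e i) = 1" if "i \<in> {1..k}" for i
    using v[OF that] e(2)[OF that] by (auto simp: v'_def unit_sphere_def Rd_iff)
  have inc': "ip d (generic_point d y j) (v' (c j)) = b' (c j)" if "j \<in> S" for j
    unfolding v'_def b'_def ip_commute[of d "generic_point d y j"] ip_scaleR_left
    by (simp add: ip_commute[of d "v (c j)"] c(2)[OF that])
  have "\<exists>X. finite X \<and> card X + card \<O> \<le> k * (d - 1) \<and> (\<forall>i\<in>{1..k}. v' i \<in> vectors_over X)"
    using kd
  proof
    assume "\<O> = {}"
    define J where "J = (SIGMA i:{1..k}. {..<d} - {e i})"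
    let ?X = "(\<lambda>(i, l). v' i l) ` J"
    have "finite J" by (simp add: J_def)
    have "v' i l \<in> field_gen ?X" if "i \<in> {1..k}" for i l
    proof -
      consider "l = e i" | "l \<ge> d" | "(i, l) \<in> J" using \<open>i \<in> {1..k}\<close> by (force simp: J_def)
      then show ?thesis
      proof cases
        case 1 then show ?thesis using v'(2)[OF that] field_gen.one by simp
      next
        case 2 then show ?thesis using v'(1)[OF that] field_gen_zero by (simp add: Rd_iff)
      next
        case 3 then show ?thesis by (intro field_gen.gen) force
      qed
    qed
    then have "\<forall>i\<in>{1..k}. v' i \<in> vectors_over ?X" by (simp add: vectors_over_iff)
    moreover have "card ?X \<le> card J" using \<open>finite J\<close> by (rule card_image_le)
    moreover have "card J = (\<Sum>i\<in>{1..k}. d - 1)"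
      unfolding J_def using e(1) by (subst card_SigmaI) (auto intro!: sum.cong simp: card_Diff_singleton)
    ultimately show ?thesis using \<open>finite J\<close> \<open>\<O> = {}\<close> by (intro exI[of _ ?X]) simp
  next
    assume "k \<le> d"
    have "ip d (v' r) (v' s) = 0" if "(r, s) \<in> \<O>" for r s
      unfolding v'_def ip_scaleR_left ip_commute[of d "v r"]
      by (simp add: ip_commute[of d _ "v r"] orth[OF that])
    then show ?thesis
      using orthogonal_family_parameters[where v = v' and e = e, OF \<open>k \<le> d\<close> v' _ \<O>] by blast
  qed
  then obtain X where X: "finite X" "card X + card \<O> \<le> k * (d - 1)" "\<And>i. i \<in> {1..k} \<Longrightarrow> v' i \<in> vectors_over X"
    by blast
  have "card S \<le> card X + k"
    using card_incidences_le[where v = v' and b = b' and c = c and e = e, OF y S X(1) c(1) inc' X(3) e(1) v'(2)] .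
  moreover have "k * (d - 1) + k = k * d" using e(1)[of 1] False by (cases d) auto
  ultimately show ?thesis using X(2) by simp
qed

section \<open>Masses concentrated near finitely many points\<close>

text \<open>
  For \<open>s\<close> in \<open>{t..<t + 1}\<close> the curve runs through an arc near \<open>p t\<close>, which is a piece of the moment curve
  scaled by \<open>\<epsilon>\<close>.  The powers start at 1 and are not shifted back to \<open>s - t\<close>: all that matters is that
  they stay bounded and that a hyperplane meets each arc in the zeros of a nonzero polynomial.
\<close>

definition curve :: "nat \<Rightarrow> (nat \<Rightarrow> nat \<Rightarrow> real) \<Rightarrow> real \<Rightarrow> real \<Rightarrow> nat \<Rightarrow> real" where
  "curve d p \<epsilon> s = (\<lambda>l. if l < d then p (nat \<lfloor>s\<rfloor>) l + \<epsilon> * s ^ Suc l else 0)"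

definition curve_mass :: "nat \<Rightarrow> nat \<Rightarrow> (nat \<Rightarrow> nat \<Rightarrow> real) \<Rightarrow> real \<Rightarrow> (nat \<Rightarrow> real) measure" where
  "curve_mass d n p \<epsilon> =
    distr (restrict_space lborel {0..<real n}) (restrict_space borel (Rd d)) (curve d p \<epsilon>)"

lemma curve_in_Rd: "curve d p \<epsilon> s \<in> Rd d"
  by (simp add: curve_def Rd_iff)

lemma measurable_curve: "curve d p \<epsilon> \<in> measurable (restrict_space lborel A) (restrict_space borel (Rd d))"
proof (rule measurable_restrict_space2)
  show "curve d p \<epsilon> \<in> borel_measurable (restrict_space lborel A)"
  proof (rule measurable_restrict_space1, rule measurable_coordinatewise_then_product)
    fix l
    show "(\<lambda>s. curve d p \<epsilon> s l) \<in> borel_measurable lborel" unfolding curve_def by measurable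
  qed
qed (auto intro: curve_in_Rd[simplified])

lemma emeasure_curve_mass:
  assumes "B \<in> sets (restrict_space borel (Rd d))"
  shows "emeasure (curve_mass d n p \<epsilon>) B = emeasure lborel {s\<in>{0..<real n}. curve d p \<epsilon> s \<in> B}"
proof -
  have "emeasure (curve_mass d n p \<epsilon>) B =
    emeasure (restrict_space lborel {0..<real n}) (curve d p \<epsilon> -` B \<inter> space (restrict_space lborel {0..<real n}))"
    unfolding curve_mass_def by (rule emeasure_distr[OF measurable_curve assms])
  also have "\<dots> = emeasure lborel (curve d p \<epsilon> -` B \<inter> space (restrict_space lborel {0..<real n}))"
    by (rule emeasure_restrict_space) (auto simp: space_restrict_space)
  also have "curve d p \<epsilon> -` B \<inter> space (restrict_space lborel {0..<real n}) = {s\<in>{0..<real n}. curve d p \<epsilon> s \<in> B}"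
    by (auto simp: space_restrict_space)
  finally show ?thesis .
qed

lemma measurable_ip: "(\<lambda>u. ip d u v) \<in> borel_measurable borel"
  unfolding ip_def by (intro borel_measurable_continuous_onI continuous_intros continuous_on_product_coordinates)

lemma sets_hyperplane: "hyperplane d v b \<in> sets (restrict_space borel (Rd d))"
proof -
  have "{u \<in> space borel. ip d u v = b} \<in> sets borel" using measurable_ip by measurable
  moreover have "hyperplane d v b = Rd d \<inter> {u \<in> space borel. ip d u v = b}" by (auto simp: hyperplane_def)
  ultimately show ?thesis by (auto simp: sets_restrict_space)
qed

lemma sets_halfspace: "halfspace d v b g \<in> sets (restrict_space borel (Rd d))"
proof -
  have "{u \<in> space borel. ip d u v \<ge> b} \<in> sets borel" "{u \<in> space borel. ip d u v \<le> b} \<in> sets borel"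
    using measurable_ip by measurable
  moreover have "halfspace d v b g = Rd d \<inter> (if g = 0 then {u \<in> space borel. ip d u v \<ge> b} else {u \<in> space borel. ip d u v \<le> b})"
    by (auto simp: halfspace_def)
  ultimately show ?thesis by (auto simp: sets_restrict_space)
qed

lemma sets_Inter_halfspace:
  assumes "finite J" "J \<noteq> {}"
  shows "(\<Inter>j\<in>J. halfspace d (v j) (b j) (g j)) \<in> sets (restrict_space borel (Rd d))"
  using assms by (intro sets.finite_INT) (auto intro: sets_halfspace)

lemma emeasure_curve_mass_Rd: "emeasure (curve_mass d n p \<epsilon>) (Rd d) = ennreal (real n)"
proof -
  have "{s\<in>{0..<real n}. curve d p \<epsilon> s \<in> Rd d} = {0..<real n}" using curve_in_Rd by blast
  moreover have "Rd d \<in> sets (restrict_space borel (Rd d))"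
    by (metis sets.top space_restrict_space2 space_restrict_space space_borel inf_top.right_neutral)
  ultimately show ?thesis by (simp only: emeasure_curve_mass) simp
qed

text \<open>
  On the arc at \<open>p t\<close> the equation of a hyperplane becomes a polynomial equation in \<open>s\<close>, which is nonzero
  since its higher coefficients are \<open>\<epsilon>\<close> times the entries of the normal vector.
\<close>

lemma mass_curve_mass:
  assumes "\<epsilon> > 0" "n > 0"
  shows "mass d (curve_mass d n p \<epsilon>)"
proof -
  have "emeasure (curve_mass d n p \<epsilon>) (hyperplane d v b) = 0" if v: "v \<in> unit_sphere d" for v b
  proof -
    obtain l where l: "l < d" "v l \<noteq> 0" using unit_sphere_nonzero[OF v] by blast
    define q where "q t = [:(\<Sum>l<d. p t l * v l) - b:] + (\<Sum>l<d. monom (\<epsilon> * v l) (Suc l))" for t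
    have "coeff (q t) (Suc l) = \<epsilon> * v l" for t
      using l by (simp add: q_def coeff_sum coeff_pCons)
    then have "q t \<noteq> 0" for t using l assms by (metis coeff_0 mult_eq_0_iff less_irrefl)
    then have fin: "finite (\<Union>t<n. {s. poly (q t) s = 0})" by (auto intro: poly_roots_finite)
    have "{s\<in>{0..<real n}. curve d p \<epsilon> s \<in> hyperplane d v b} \<subseteq> (\<Union>t<n. {s. poly (q t) s = 0})"
    proof
      fix s assume s: "s \<in> {s\<in>{0..<real n}. curve d p \<epsilon> s \<in> hyperplane d v b}"
      have "poly (q (nat \<lfloor>s\<rfloor>)) s = ip d (curve d p \<epsilon> s) v - b"
        by (simp add: q_def poly_sum poly_monom ip_def curve_def algebra_simps sum.distrib)
      also have "\<dots> = 0" using s by (simp add: hyperplane_def)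
      finally have "poly (q (nat \<lfloor>s\<rfloor>)) s = 0" .
      moreover have "nat \<lfloor>s\<rfloor> < n" using s by (simp add: nat_less_iff floor_less_iff)
      ultimately show "s \<in> (\<Union>t<n. {s. poly (q t) s = 0})" by blast
    qed
    then have "finite {s\<in>{0..<real n}. curve d p \<epsilon> s \<in> hyperplane d v b}" using fin finite_subset by blast
    then show ?thesis by (simp only: emeasure_curve_mass[OF sets_hyperplane] emeasure_lborel_countable countable_finite)
  qed
  then show ?thesis
    unfolding mass_def using assms
    by (simp only: emeasure_curve_mass_Rd) (simp add: curve_mass_def)
qed

lemma equipartition_curve_mass:
  assumes "equipartition d J v b (curve_mass d n p \<epsilon>)" "finite J" "J \<noteq> {}" "g \<in> J \<rightarrow> {0, 1}"
  shows "emeasure lborel {s\<in>{0..<real n}. \<forall>j\<in>J. curve d p \<epsilon> s \<in> halfspace d (v j) (b j) (g j)}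
    = ennreal (real n / 2 ^ card J)"
proof -
  let ?M = "curve_mass d n p \<epsilon>" and ?O = "\<Inter>j\<in>J. halfspace d (v j) (b j) (g j)"
  have "measure ?M ?O = measure ?M (Rd d) / 2 ^ card J" using assms by (simp add: equipartition_def)
  moreover have "measure ?M (Rd d) = real n" by (simp only: measure_def emeasure_curve_mass_Rd) simp
  moreover have "emeasure ?M ?O \<noteq> \<infinity>"
  proof -
    have "emeasure ?M ?O = emeasure lborel {s\<in>{0..<real n}. curve d p \<epsilon> s \<in> ?O}"
      by (rule emeasure_curve_mass[OF sets_Inter_halfspace[OF assms(2,3)]])
    also have "\<dots> \<le> emeasure lborel {0..<real n}" by (rule emeasure_mono) auto
    finally show ?thesis by (auto simp: top_unique)
  qed
  ultimately have "emeasure ?M ?O = ennreal (real n / 2 ^ card J)"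
    by (metis emeasure_eq_ennreal_measure infinity_ennreal_def)
  then show ?thesis
    by (simp only: emeasure_curve_mass[OF sets_Inter_halfspace[OF assms(2,3)]] INT_iff)
qed

lemma abs_ip_le:
  assumes "v \<in> unit_sphere d" "\<And>l. l < d \<Longrightarrow> \<bar>u l\<bar> \<le> K"
  shows "\<bar>ip d u v\<bar> \<le> real d * K"
proof -
  have "\<bar>ip d u v\<bar> \<le> (\<Sum>l<d. \<bar>u l * v l\<bar>)" unfolding ip_def by (rule sum_abs)
  also have "\<dots> \<le> (\<Sum>l<d. K)"
  proof (rule sum_mono)
    fix l assume "l \<in> {..<d}"
    then have "\<bar>u l\<bar> * \<bar>v l\<bar> \<le> K * 1"
      using assms unit_sphere_abs_le_1[OF assms(1), of l] by (intro mult_mono) (auto intro: order_trans[OF abs_ge_zero])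
    then show "\<bar>u l * v l\<bar> \<le> K" by (simp add: abs_mult)
  qed
  finally show ?thesis by simp
qed

lemma curve_offset:
  assumes "s \<in> {0..<real n}" "\<epsilon> \<ge> 0" "l < d"
  shows "\<bar>curve d p \<epsilon> s l - p (nat \<lfloor>s\<rfloor>) l\<bar> \<le> \<epsilon> * real n ^ d"
proof -
  have "n \<ge> 1" using assms by (cases n) auto
  have "s ^ Suc l \<le> real n ^ Suc l" using assms by (intro power_mono) auto
  also have "\<dots> \<le> real n ^ d" using \<open>n \<ge> 1\<close> assms(3) by (intro power_increasing) auto
  finally show ?thesis using assms by (simp add: curve_def abs_mult mult_left_mono del: power_Suc)
qed

text \<open>
  If all hyperplanes were further away from \<open>p t\<close> than the size of its arc, the arc would lie in a single
  orthant.  But the arc has measure 1, and an orthant has measure \<open>n / 2 ^ card J < 1\<close>.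
\<close>

lemma equipartition_hyperplane_near_point:
  assumes eq: "equipartition d J v b (curve_mass d n p \<epsilon>)" and J: "finite J" "J \<noteq> {}"
    and n: "n < 2 ^ card J" and "t < n" and "\<epsilon> > 0" and v: "\<And>j. j \<in> J \<Longrightarrow> v j \<in> unit_sphere d"
  shows "\<exists>j\<in>J. \<bar>ip d (p t) (v j) - b j\<bar> \<le> \<epsilon> * (real d * real n ^ d)"
proof (rule ccontr)
  assume *: "\<not> ?thesis"
  define g where "g j = (if ip d (p t) (v j) > b j then 0 else 1 :: nat)" for j
  have "curve d p \<epsilon> s \<in> halfspace d (v j) (b j) (g j)" if "j \<in> J" and s: "s \<in> {real t..<real t + 1}" for j s
  proof -
    have t: "nat \<lfloor>s\<rfloor> = t" using s by (simp add: nat_eq_iff floor_eq_iff)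
    have "s \<in> {0..<real n}" using s \<open>t < n\<close> by auto
    then have "\<bar>ip d (curve d p \<epsilon> s - p t) (v j)\<bar> \<le> real d * (\<epsilon> * real n ^ d)"
      using curve_offset[of s n \<epsilon> _ d p] \<open>\<epsilon> > 0\<close> t by (intro abs_ip_le v that) auto
    moreover have "ip d (curve d p \<epsilon> s - p t) (v j) = ip d (curve d p \<epsilon> s) (v j) - ip d (p t) (v j)"
      by (rule ip_diff_left)
    moreover have "\<bar>ip d (p t) (v j) - b j\<bar> > \<epsilon> * (real d * real n ^ d)" using * that by auto
    ultimately show ?thesis
      using curve_in_Rd[of d p \<epsilon> s] by (auto simp: halfspace_def g_def algebra_simps abs_if split: if_splits)
  qed
  then have sub: "{real t..<real t + 1} \<subseteq> {s\<in>{0..<real n}. \<forall>j\<in>J. curve d p \<epsilon> s \<in> halfspace d (v j) (b j) (g j)}"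
    (is "_ \<subseteq> ?R") using \<open>t < n\<close> by auto
  have R: "emeasure lborel ?R = ennreal (real n / 2 ^ card J)"
    by (rule equipartition_curve_mass[OF eq J]) (auto simp: g_def)
  have "?R \<in> sets lborel"
  proof (rule ccontr)
    assume "?R \<notin> sets lborel"
    then have "emeasure lborel ?R = 0" by (rule emeasure_notin_sets)
    then have "ennreal (real n / 2 ^ card J) = 0" unfolding R .
    moreover have "real n / 2 ^ card J > 0" using \<open>t < n\<close> by simp
    ultimately show False by (metis ennreal_eq_0_iff not_le)
  qed
  then have "emeasure lborel {real t..<real t + 1} \<le> emeasure lborel ?R" by (rule emeasure_mono[OF sub])
  then have "1 \<le> real n / 2 ^ card J" unfolding R by simp
  moreover have "real n < 2 ^ card J" using n by (metis of_nat_less_iff of_nat_numeral of_nat_power)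
  ultimately show False by (simp add: field_simps)
qed

text \<open>
  Both sides of each hyperplane contain an orthant, which has positive measure and thus meets the
  curve; so the offset lies between two values of \<open>ip d\<close> on the curve.
\<close>

lemma equipartition_offset_bounded:
  assumes eq: "equipartition d J v b (curve_mass d n p \<epsilon>)" and J: "finite J" "j \<in> J"
    and "n > 0" and "0 < \<epsilon>" "\<epsilon> \<le> 1" and v: "v j \<in> unit_sphere d"
    and K: "\<And>t l. t < n \<Longrightarrow> l < d \<Longrightarrow> \<bar>p t l\<bar> \<le> K"
  shows "\<bar>b j\<bar> \<le> real d * (K + real n ^ d)"
proof -
  have side: "\<exists>s\<in>{0..<real n}. curve d p \<epsilon> s \<in> halfspace d (v j) (b j) h" if "h \<in> {0, 1}" for h :: nat
  proof (rule ccontr)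
    assume "\<not> ?thesis"
    then have "{s\<in>{0..<real n}. \<forall>i\<in>J. curve d p \<epsilon> s \<in> halfspace d (v i) (b i) h} = {}" using J by blast
    moreover have "emeasure lborel {s\<in>{0..<real n}. \<forall>i\<in>J. curve d p \<epsilon> s \<in> halfspace d (v i) (b i) h}
        = ennreal (real n / 2 ^ card J)"
      using that J by (intro equipartition_curve_mass[OF eq J(1)]) auto
    ultimately have "ennreal (real n / 2 ^ card J) = 0" by (simp only: emeasure_empty)
    moreover have "real n / 2 ^ card J > 0" using \<open>n > 0\<close> by simp
    ultimately show False by (metis ennreal_eq_0_iff not_le)
  qed
  have bound: "\<bar>ip d (curve d p \<epsilon> s) (v j)\<bar> \<le> real d * (K + real n ^ d)" if s: "s \<in> {0..<real n}" for s
  proof (rule abs_ip_le[OF v])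
    fix l assume "l < d"
    have "\<bar>p (nat \<lfloor>s\<rfloor>) l\<bar> \<le> K" using s \<open>l < d\<close> by (intro K) (auto simp: nat_less_iff floor_less_iff)
    moreover have "\<bar>curve d p \<epsilon> s l - p (nat \<lfloor>s\<rfloor>) l\<bar> \<le> 1 * real n ^ d"
      using curve_offset[OF s _ \<open>l < d\<close>, of \<epsilon> p] \<open>0 < \<epsilon>\<close> \<open>\<epsilon> \<le> 1\<close> mult_right_mono[of \<epsilon> 1 "real n ^ d"] by simp
    ultimately show "\<bar>curve d p \<epsilon> s l\<bar> \<le> K + real n ^ d" by simp
  qed
  obtain s where s: "s \<in> {0..<real n}" "curve d p \<epsilon> s \<in> halfspace d (v j) (b j) 0" using side[of 0] by auto
  obtain s' where s': "s' \<in> {0..<real n}" "curve d p \<epsilon> s' \<in> halfspace d (v j) (b j) 1" using side[of 1] by auto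
  have "b j \<le> ip d (curve d p \<epsilon> s) (v j)" "ip d (curve d p \<epsilon> s') (v j) \<le> b j"
    using s(2) s'(2) by (simp_all add: halfspace_def)
  then show ?thesis using bound[OF s(1)] bound[OF s'(1)] by linarith
qed

section \<open>Limits of hyperplanes\<close>

lemma finite_family_convergent_subsequence:
  fixes x :: "'i \<Rightarrow> nat \<Rightarrow> real"
  assumes "finite F" "\<And>f. f \<in> F \<Longrightarrow> bounded (range (x f))"
  shows "\<exists>r L. strict_mono (r :: nat \<Rightarrow> nat) \<and> (\<forall>f\<in>F. (\<lambda>N. x f (r N)) \<longlonglongrightarrow> L f)"
  using assms
proof (induction F rule: finite_induct)
  case empty
  show ?case by (intro exI[of _ id]) (auto simp: strict_mono_def)
next
  case (insert g F)
  then obtain r L where r: "strict_mono r" "\<And>f. f \<in> F \<Longrightarrow> (\<lambda>N. x f (r N)) \<longlonglongrightarrow> L f" by auto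
  have "bounded (range (x g \<circ> r))" using insert.prems by (rule bounded_subset) auto
  then obtain l r' where r': "strict_mono (r' :: nat \<Rightarrow> nat)" "(x g \<circ> r \<circ> r') \<longlonglongrightarrow> l"
    using bounded_imp_convergent_subsequence by blast
  have "(\<lambda>N. x f ((r \<circ> r') N)) \<longlonglongrightarrow> (L(g := l)) f" if "f \<in> insert g F" for f
  proof (cases "f = g")
    case True
    then show ?thesis using r'(2) by (simp add: o_def)
  next
    case False
    then have "(\<lambda>N. x f (r N)) \<longlonglongrightarrow> L f" using that r by auto
    from LIMSEQ_subseq_LIMSEQ[OF this r'(1)] show ?thesis using False by (simp add: o_def)
  qed
  then show ?case using strict_mono_o[OF r(1) r'(1)] by blast
qed

lemma hyperplanes_convergent_subsequence:
  fixes v :: "nat \<Rightarrow> nat \<Rightarrow> nat \<Rightarrow> real" and b :: "nat \<Rightarrow> nat \<Rightarrow> real"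
  assumes v: "\<And>N i. i \<in> I \<Longrightarrow> v N i \<in> unit_sphere d" and b: "\<And>N i. i \<in> I \<Longrightarrow> \<bar>b N i\<bar> \<le> B" and "finite I"
  shows "\<exists>r v' b'. strict_mono (r :: nat \<Rightarrow> nat) \<and> (\<forall>i\<in>I. v' i \<in> unit_sphere d \<and>
    (\<lambda>N. b (r N) i) \<longlonglongrightarrow> b' i \<and> (\<forall>l. (\<lambda>N. v (r N) i l) \<longlonglongrightarrow> v' i l))"
proof -
  \<comment> \<open>The coordinate \<open>l = d\<close>, where \<open>v N i\<close> vanishes anyway, carries the offset.\<close>
  define x where "x = (\<lambda>(i, l) N. if l < d then v N i l else b N i)"
  have "bounded (range (x f))" if "f \<in> I \<times> {..d}" for f
  proof -
    obtain i l where f: "f = (i, l)" "i \<in> I" using \<open>f \<in> I \<times> {..d}\<close> by auto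
    have "\<bar>x f N\<bar> \<le> max 1 B" for N
      using b[OF f(2), of N] unit_sphere_abs_le_1[OF v[OF f(2)], of N l] by (auto simp: x_def f(1))
    then show ?thesis unfolding bounded_iff by (intro exI[of _ "max 1 B"]) auto
  qed
  moreover have "finite (I \<times> {..d})" using \<open>finite I\<close> by simp
  ultimately obtain r L where r: "strict_mono r" "\<And>f. f \<in> I \<times> {..d} \<Longrightarrow> (\<lambda>N. x f (r N)) \<longlonglongrightarrow> L f"
    using finite_family_convergent_subsequence[of "I \<times> {..d}" x] by blast
  define v' where "v' i l = (if l < d then L (i, l) else 0)" for i l
  have lim: "(\<lambda>N. v (r N) i l) \<longlonglongrightarrow> v' i l" if "i \<in> I" for i l
  proof (cases "l < d")
    case True
    then show ?thesis using r(2)[of "(i, l)"] that by (simp add: x_def v'_def)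
  next
    case False
    then show ?thesis using v[OF that] by (simp add: v'_def unit_sphere_def Rd_iff)
  qed
  have "v' i \<in> unit_sphere d" if "i \<in> I" for i
  proof -
    have "(\<lambda>N. ip d (v (r N) i) (v (r N) i)) \<longlonglongrightarrow> ip d (v' i) (v' i)"
      unfolding ip_def by (intro tendsto_sum tendsto_mult lim that)
    moreover have "(\<lambda>N. ip d (v (r N) i) (v (r N) i)) = (\<lambda>N. 1)"
      using v[OF that] by (simp add: unit_sphere_def)
    ultimately have "ip d (v' i) (v' i) = 1" by (simp add: LIMSEQ_const_iff)
    then show ?thesis by (simp add: unit_sphere_def Rd_iff v'_def)
  qed
  moreover have "(\<lambda>N. b (r N) i) \<longlonglongrightarrow> L (i, d)" if "i \<in> I" for i
    using r(2)[of "(i, d)"] that by (simp add: x_def)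
  ultimately show ?thesis using r(1) lim
    by (intro exI[of _ r] exI[of _ v'] exI[of _ "\<lambda>i. L (i, d)"]) auto
qed

section \<open>The lower bound\<close>

lemma pred_square_less_pow2: "k \<ge> 1 \<Longrightarrow> k * (k - 1) < 2 ^ k - (1::nat)"
proof (induction k rule: nat_induct_at_least)
  case (Suc n)
  show ?case
  proof (cases "n \<le> 2")
    case True
    then have "n = 1 \<or> n = 2" using Suc.hyps by auto
    then show ?thesis by (auto simp: eval_nat_numeral)
  next
    case False
    then obtain j where "n = j + 3" by (metis add.commute le_Suc_ex not_less_eq_eq numeral_2_eq_2 numeral_3_eq_3)
    then show ?thesis using Suc.IH by (simp add: algebra_simps power_add)
  qed
qed simp

text \<open>
  Distinct points need distinct blocks of the generic sequence; the leading 0 or 1 separates the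
  points that carry masses from those that span the affine subspaces.
\<close>

definition mass_index :: "nat \<Rightarrow> nat \<Rightarrow> nat \<Rightarrow> nat" where
  "mass_index i j t = to_nat (0::nat, i, j, t)"

definition subspace_index :: "nat \<Rightarrow> nat \<Rightarrow> nat" where
  "subspace_index i t = to_nat (1::nat, i, t, 0::nat)"

text \<open>
  The hyperplanes \<open>v N, b N\<close> solve the problem for arcs of size \<open>1 / (N + 1)\<close>, and \<open>v', b'\<close> is a limit of
  a subsequence.  Orthogonality and the containment of the \<open>A i\<close> are closed conditions and pass to the
  limit; of the equipartitions only the incidences with the points survive.  The set \<open>S\<close> collects all points that lie on a limit hyperplane.
\<close>

lemma C_bound_le_if_admissible:
  assumes k: "1 \<le> k" and m1: "1 \<le> m 1" and \<O>: "\<O> \<subseteq> {(r, s). 1 \<le> r \<and> r < s \<and> s \<le> k}"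
    and adm: "admissible m a \<O> k d"
  shows "C_bound m a \<O> k \<le> k * d"
proof -
  obtain y where y: "generic y" using exists_generic by blast
  define P where "P = generic_point d y"
  define n where "n i = (2::nat) ^ (k - i + 1) - 1" for i
  define \<mu> where "\<mu> N i j = curve_mass d (n i) (\<lambda>t. P (mass_index i j t)) (1 / real (Suc N))" for N i j
  define Q where "Q i = subspace_index i ` {..<a i}" for i
  define A where "A i = affine hull (P ` Q i)" for i
  have n_pos: "n i > 0" for i
    using one_less_power[of "2::nat" "k - i + 1"] by (simp add: n_def)
  have n_less: "n i < 2 ^ card {i..k}" if "i \<in> {1..k}" for i
    using that by (simp add: n_def Suc_diff_le)
  have cQ: "finite (Q i)" "card (Q i) = a i" for i
    by (auto simp: Q_def subspace_index_def card_image inj_on_def)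
  have "mass d (\<mu> N i j)" for N i j
    unfolding \<mu>_def using n_pos by (intro mass_curve_mass) auto
  moreover have "affine_subspace d (a i) (A i)" if "i \<in> {1..k}" for i
    using affine_subspace_generic_points[OF y cQ(1)[of i], of d] adm that
    by (simp add: A_def P_def cQ(2) admissible_def)
  moreover define sol where "sol N v b \<longleftrightarrow> (\<forall>i\<in>{1..k}. v i \<in> unit_sphere d) \<and>
      (\<forall>(r, s)\<in>\<O>. ip d (v r) (v s) = 0) \<and>
      (\<forall>i\<in>{1..k}. A i \<subseteq> hyperplane d (v i) (b i)) \<and>
      (\<forall>i\<in>{1..k}. \<forall>j\<in>{1..m i}. equipartition d {i..k} v b (\<mu> N i j))" for N v b
  ultimately have "\<exists>v b. sol N v b" for N
    using adm unfolding admissible_def sol_def by blast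
  then obtain v b where sol: "\<And>N. sol N (v N) (b N)" by metis
  have v: "v N i \<in> unit_sphere d" if "i \<in> {1..k}" for N i
    using sol[of N] that by (simp add: sol_def)
  have orth: "ip d (v N r) (v N s) = 0" if "(r, s) \<in> \<O>" for N r s
    using sol[of N] that by (auto simp: sol_def)
  have Av: "A i \<subseteq> hyperplane d (v N i) (b N i)" if "i \<in> {1..k}" for N i
    using sol[of N] that by (simp add: sol_def)
  have eq: "equipartition d {i..k} (v N) (b N) (\<mu> N i j)" if "i \<in> {1..k}" "j \<in> {1..m i}" for N i j
    using sol[of N] that by (simp add: sol_def)
  obtain K where K: "\<And>t l. t < n 1 \<Longrightarrow> l < d \<Longrightarrow> \<bar>P (mass_index 1 1 t) l\<bar> \<le> K"
  proof
    fix t l assume "t < n 1" "l < d"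
    then show "\<bar>P (mass_index 1 1 t) l\<bar> \<le> (\<Sum>(t, l)\<in>{..<n 1} \<times> {..<d}. \<bar>P (mass_index 1 1 t) l\<bar>)"
      using member_le_sum[of "(t, l)" "{..<n 1} \<times> {..<d}" "\<lambda>(t, l). \<bar>P (mass_index 1 1 t) l\<bar>"] by auto
  qed
  have "\<bar>b N i\<bar> \<le> real d * (K + real (n 1) ^ d)" if "i \<in> {1..k}" for N i
  proof (rule equipartition_offset_bounded[where J = "{1..k}" and \<epsilon> = "1 / real (Suc N)"])
    show "equipartition d {1..k} (v N) (b N) (curve_mass d (n 1) (\<lambda>t. P (mass_index 1 1 t)) (1 / real (Suc N)))"
      using eq[of 1 1 N] k m1 by (simp add: \<mu>_def)
  qed (use that n_pos v K in auto)
  from hyperplanes_convergent_subsequence[where I = "{1..k}" and v = v and b = b, OF v this finite_atLeastAtMost]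
  obtain r v' b' where r: "strict_mono (r :: nat \<Rightarrow> nat)"
    and v': "\<And>i. i \<in> {1..k} \<Longrightarrow> v' i \<in> unit_sphere d"
    and limb: "\<And>i. i \<in> {1..k} \<Longrightarrow> (\<lambda>N. b (r N) i) \<longlonglongrightarrow> b' i"
    and limv: "\<And>i l. i \<in> {1..k} \<Longrightarrow> (\<lambda>N. v (r N) i l) \<longlonglongrightarrow> v' i l"
    by blast
  have lim: "(\<lambda>N. ip d u (v (r N) i) - b (r N) i) \<longlonglongrightarrow> ip d u (v' i) - b' i" if "i \<in> {1..k}" for u i
    unfolding ip_def using limb limv that by (intro tendsto_intros) auto
  have orth': "ip d (v' i) (v' j) = 0" if "(i, j) \<in> \<O>" for i j
  proof -
    have "i \<in> {1..k}" "j \<in> {1..k}" using that \<O> by auto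
    then have "(\<lambda>N. ip d (v (r N) i) (v (r N) j)) \<longlonglongrightarrow> ip d (v' i) (v' j)"
      unfolding ip_def using limv by (intro tendsto_intros) auto
    then show ?thesis by (simp add: orth[OF that] LIMSEQ_const_iff)
  qed
  have subspace_incidence: "ip d (P q) (v' i) = b' i" if "i \<in> {1..k}" "q \<in> Q i" for i q
  proof -
    have "P q \<in> A i" unfolding A_def using that by (intro hull_inc) auto
    then have "ip d (P q) (v N i) - b N i = 0" for N
      using Av[OF that(1), of N] by (auto simp: hyperplane_def)
    then show ?thesis using lim[OF that(1), of "P q"] by (simp add: LIMSEQ_const_iff)
  qed
  have mass_incidence: "\<exists>c\<in>{1..k}. ip d (P (mass_index i j t)) (v' c) = b' c"
    if i: "i \<in> {1..k}" and j: "j \<in> {1..m i}" and t: "t < n i" for i j t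
  proof (rule ccontr)
    assume no: "\<not> ?thesis"
    let ?p = "P (mass_index i j t)"
    define \<delta> where "\<delta> N = 1 / real (Suc N) * (real d * real (n i) ^ d)" for N
    have "\<delta> \<longlonglongrightarrow> 0 * (real d * real (n i) ^ d)"
      unfolding \<delta>_def by (intro tendsto_mult LIMSEQ_Suc[OF lim_1_over_n] tendsto_const)
    then have "(\<lambda>N. \<delta> (r N)) \<longlonglongrightarrow> 0" using LIMSEQ_subseq_LIMSEQ[OF _ r, of \<delta> 0] by (simp add: o_def)
    then have "\<forall>\<^sub>F N in sequentially. \<delta> (r N) < \<bar>ip d ?p (v (r N) c) - b (r N) c\<bar>" if c: "c \<in> {i..k}" for c
    proof -
      have c: "c \<in> {1..k}" using c i by auto
      have "(\<lambda>N. \<bar>ip d ?p (v (r N) c) - b (r N) c\<bar> - \<delta> (r N)) \<longlonglongrightarrow> \<bar>ip d ?p (v' c) - b' c\<bar> - 0"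
        by (rule tendsto_diff[OF tendsto_rabs[OF lim[OF c]]]) fact
      moreover have "\<bar>ip d ?p (v' c) - b' c\<bar> - 0 > 0" using no c by auto
      ultimately have "\<forall>\<^sub>F N in sequentially. 0 < \<bar>ip d ?p (v (r N) c) - b (r N) c\<bar> - \<delta> (r N)"
        by (rule order_tendstoD(1))
      then show ?thesis by simp
    qed
    then have "\<forall>\<^sub>F N in sequentially. \<forall>c\<in>{i..k}. \<delta> (r N) < \<bar>ip d ?p (v (r N) c) - b (r N) c\<bar>"
      by (intro eventually_ball_finite) auto
    then obtain N where N: "\<forall>c\<in>{i..k}. \<delta> (r N) < \<bar>ip d ?p (v (r N) c) - b (r N) c\<bar>"
      using eventually_happens'[OF sequentially_bot] by blast
    have "\<exists>c\<in>{i..k}. \<bar>ip d ?p (v (r N) c) - b (r N) c\<bar> \<le> 1 / real (Suc (r N)) * (real d * real (n i) ^ d)"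
    proof (rule equipartition_hyperplane_near_point[where p = "\<lambda>t. P (mass_index i j t)"])
      show "equipartition d {i..k} (v (r N)) (b (r N)) (curve_mass d (n i) (\<lambda>t. P (mass_index i j t)) (1 / real (Suc (r N))))"
        using eq[OF i j, of "r N"] by (simp add: \<mu>_def)
    qed (use i t n_less v in auto)
    with N show False by (auto simp: \<delta>_def)
  qed
  define SM where "SM = (SIGMA i:{1..k}. {1..m i} \<times> {..<n i})"
  define SQ where "SQ = (SIGMA i:{1..k}. {..<a i})"
  define S where "S = (\<lambda>(i, j, t). mass_index i j t) ` SM \<union> (\<lambda>(i, t). subspace_index i t) ` SQ"
  have fin: "finite SM" "finite SQ" by (auto simp: SM_def SQ_def)
  have "card S = card SM + card SQ"
  proof -
    have "card S = card ((\<lambda>(i, j, t). mass_index i j t) ` SM) + card ((\<lambda>(i, t). subspace_index i t) ` SQ)"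
      unfolding S_def using fin by (intro card_Un_disjoint) (auto simp: mass_index_def subspace_index_def)
    moreover have "card ((\<lambda>(i, j, t). mass_index i j t) ` SM) = card SM"
      by (rule card_image) (auto simp: inj_on_def mass_index_def)
    moreover have "card ((\<lambda>(i, t). subspace_index i t) ` SQ) = card SQ"
      by (rule card_image) (auto simp: inj_on_def subspace_index_def)
    ultimately show ?thesis by simp
  qed
  also have "\<dots> = (\<Sum>i=1..k. m i * n i) + (\<Sum>i=1..k. a i)"
    by (simp add: SM_def SQ_def card_cartesian_product)
  finally have cS: "card S = (\<Sum>i=1..k. m i * n i + a i)" by (simp add: sum.distrib)
  have "finite S" using fin by (simp add: S_def)
  have inc: "\<exists>i\<in>{1..k}. ip d (generic_point d y s) (v' i) = b' i" if "s \<in> S" for s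
  proof -
    consider i j t where "s = mass_index i j t" "i \<in> {1..k}" "j \<in> {1..m i}" "t < n i"
      | i where "i \<in> {1..k}" "s \<in> Q i"
      using \<open>s \<in> S\<close> by (auto simp: S_def SM_def SQ_def Q_def)
    then have "\<exists>i\<in>{1..k}. ip d (P s) (v' i) = b' i"
      using mass_incidence subspace_incidence by cases blast+
    then show ?thesis by (simp only: P_def)
  qed
  have "k \<le> d"
  proof (rule ccontr)
    assume "\<not> k \<le> d"
    have "2 ^ k - 1 \<le> m 1 * n 1 + a 1" using m1 k by (simp add: n_def trans_le_add1)
    also have "\<dots> \<le> card S" unfolding cS using k by (intro member_le_sum) auto
    also have "\<dots> \<le> k * d"
      using incidences_plus_orthogonality_le[where \<O> = "{}", OF y \<open>finite S\<close> v' inc] by simp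
    also have "\<dots> \<le> k * (k - 1)" using \<open>\<not> k \<le> d\<close> by (intro mult_le_mono2) auto
    finally show False using pred_square_less_pow2[OF k] by simp
  qed
  then have "card S + card \<O> \<le> k * d"
    by (intro incidences_plus_orthogonality_le[OF y \<open>finite S\<close> v' inc orth' \<O>]) auto
  then show ?thesis by (simp add: C_bound_def cS n_def)
qed

theorem theorem2p1:
  fixes k :: nat and m a :: "nat \<Rightarrow> nat" and \<O> :: "(nat \<times> nat) set"
  assumes "1 \<le> k"
    and "1 \<le> m 1"
    and "\<O> \<subseteq> {(r, s). 1 \<le> r \<and> r < s \<and> s \<le> k}"
  shows "enat k * Delta m a \<O> k \<ge> enat (C_bound m a \<O> k)"
proof (cases "\<exists>d. admissible m a \<O> k d")
  case True
  define D where "D = {d. admissible m a \<O> k d}"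
  obtain d0 where "enat d0 \<in> enat ` D" using True by (auto simp: D_def)
  then have "Inf (enat ` D) \<in> enat ` D"
    using LeastI[of "\<lambda>x. x \<in> enat ` D" "enat d0"] by (auto simp: Inf_enat_def)
  then obtain d where "admissible m a \<O> k d" "Delta m a \<O> k = enat d"
    by (auto simp: Delta_def D_def)
  then show ?thesis using C_bound_le_if_admissible[where m = m, OF assms] by simp
next
  case False
  then have "Delta m a \<O> k = \<infinity>" by (simp add: Delta_def top_enat_def)
  then show ?thesis using assms(1) by (simp add: enat_0_iff)
qed

end
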